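(* Let $A$ be an expansive $d\times d$ integer matrix. (i) The measure $\tilde\mu$ on $\mathcal S_A(1)$ satisfies $$\int_{\mathcal S_A(1)}f\circ\sigma_A\,d\tilde\mu=\frac1{|\det A|}\int_{\mathcal S_A(1)}f\,d\tilde\mu\qquad(f\in L^1(\mathcal S_A(1),\tilde\mu)).$$ (ii) The operators $\tilde T_k$, $k\in\mathbb Z^d$, and $\tilde U$ on $L^2(\mathcal S_A(1),\tilde\mu)$ are unitary and satisfy $$\tilde U\tilde T_k\tilde U^{-1}=\tilde T_{Ak}\qquad(k\in\mathbb Z^d),$$ so $\{\tilde U,\tilde T_k\}$ generate a representation of the group $G_A$ on $L^2(\mathcal S_A(1),\tilde\mu)$. (iii) The map $\hat i$ is a measure preserving transformation between $\mathbb R^d$ (with Lebesgue measure) and $\mathcal S_A(1)$ (with $\tilde\mu$). (iv) The operator $\mathcal W:L^2(\mathbb R^d)\to L^2(\mathcal S_A(1),\tilde\mu)$ defined by $\mathcal Wf=f\circ\hat i^{-1}$ is an intertwining isometric isomorphism: $$\mathcal W\hat T_k=\tilde T_k\mathcal W\quad(k\in\mathbb Z^d),\qquad \mathcal W\hat U=\tilde U\mathcal W.$$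
   Context: $\mathbb N=\{0,1,2,\dots\}$. An integer matrix $A$ is expansive if all its eigenvalues $\lambda$ satisfy $|\lambda|>1$; $A^T$ is the transpose. For $x\in\mathbb R^d$, $e^{2\pi i x}:=(e^{2\pi i x_1},\dots,e^{2\pi i x_d})\in\mathbb T^d$; for $z=e^{2\pi i x}\in\mathbb T^d$ and $k\in\mathbb Z^d$ put $z^k:=e^{2\pi i k\cdot x}\in\mathbb T$ and $z^A:=e^{2\pi i A^Tx}\in\mathbb T^d$; $\mathbf 1=(1,\dots,1)\in\mathbb T^d$. The solenoid is the compact abelian group $\mathcal S_A=\{(z_n)_{n\in\mathbb N}: z_n\in\mathbb T^d,\ z_{n+1}^A=z_n \text{ for all } n\in\mathbb N\}$ (coordinatewise multiplication, topology induced by the product topology), and $\sigma_A(z_0,z_1,\dots)=(z_0^A,z_0,z_1,\dots)$. $\mathcal S_A(1)$ is the set of $(z_n)_n\in\mathcal S_A$ with $\lim_{n\to\infty}z_n=\mathbf 1$. The map $\hat i(x)=(e^{2\pi i(A^T)^{-n}x})_{n\in\mathbb N}$ is a bijection from $\mathbb R^d$ onto $\mathcal S_A(1)$. The measure $\tilde\mu$ on $\mathcal S_A(1)$ is defined by $\int_{\mathcal S_A(1)}f\,d\tilde\mu=\int_{\mathbb T^d}\sum_{(z_n)_n\in\mathcal S_A(1),\,z_0=z}f((z_n)_n)\,d\mu(z)$, with $\mu$ the normalized Haar measure on $\mathbb T^d$. On $L^2(\mathcal S_A(1),\tilde\mu)$: $(\tilde T_kf)(z_0,z_1,\dots)=z_0^kf(z_0,z_1,\dots)$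 for $k\in\mathbb Z^d$, and $\tilde Uf=\sqrt{|\det A|}\,f\circ\sigma_A$. On $L^2(\mathbb R^d)$: $(\hat T_kh)(x)=e^{2\pi ik\cdot x}h(x)$ and $(\hat Uh)(x)=\sqrt{|\det A|}\,h(A^Tx)$. $\mathbb Z^d[A^{-1}]=\{A^{-j}k: j\in\mathbb N,k\in\mathbb Z^d\}$ and $G_A=\mathbb Z^d[A^{-1}]\rtimes\mathbb Z$ is the set of pairs $(j,b)$, $j\in\mathbb Z$, $b\in\mathbb Z^d[A^{-1}]$, with product $(j,b)(k,c)=(j+k,A^jc+b)$. A unitary representation of $G_A$ is determined by unitaries $U$ (the image of $(1,0)$) and $T_k$, $k\in\mathbb Z^d$ (the image of $(0,k)$, with $T_kT_l=T_{k+l}$), subject to $UT_kU^{-1}=T_{Ak}$. *)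

theory Defs
  imports "HOL-Analysis.Analysis" "HOL-Algebra.Bij"
begin

section \<open>Integer vectors and matrices\<close>

definition real_vec :: "int ^ 'd \<Rightarrow> real ^ 'd" where
  "real_vec k = (\<chi> i. real_of_int (k $ i))"

abbreviation real_mat :: "int ^ 'd ^ 'd \<Rightarrow> real ^ 'd ^ 'd" where
  "real_mat A \<equiv> map_matrix real_of_int A"

definition expansive :: "int ^ 'd ^ 'd \<Rightarrow> bool" where
  "expansive A \<longleftrightarrow>
     (\<forall>l::complex. (\<exists>v. v \<noteq> 0 \<and> map_matrix of_int A *v v = l *s v) \<longrightarrow> norm l > 1)"

text \<open>The library power \<open>M ^ n\<close> on \<open>real ^ 'd ^ 'd\<close> is the componentwise one, so
  matrix powers are defined here.\<close>

primrec mat_pow :: "real ^ 'd ^ 'd \<Rightarrow> nat \<Rightarrow> real ^ 'd ^ 'd" where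
  "mat_pow M 0 = mat 1"
| "mat_pow M (Suc n) = M ** mat_pow M n"

definition mat_powi :: "real ^ 'd ^ 'd \<Rightarrow> int \<Rightarrow> real ^ 'd ^ 'd" where
  "mat_powi M j = (if j \<ge> 0 then mat_pow M (nat j) else mat_pow (matrix_inv M) (nat (- j)))"


section \<open>The torus\<close>

definition torus :: "(complex ^ 'd) set" where
  "torus = {z. \<forall>i. norm (z $ i) = 1}"

definition e2pi :: "real ^ 'd \<Rightarrow> complex ^ 'd" where
  "e2pi x = (\<chi> i. cis (2 * pi * x $ i))"

text \<open>\<open>z\<^sup>k\<close> and \<open>z\<^sup>A\<close> for \<open>z\<close> in the torus.  Independence of the chosen
  logarithm \<open>x\<close> is shown in \<open>torus_char_e2pi\<close> and \<open>torus_endo_e2pi\<close> below.\<close>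

definition torus_char :: "complex ^ 'd \<Rightarrow> int ^ 'd \<Rightarrow> complex" where
  "torus_char z k = (THE c. \<exists>x. z = e2pi x \<and> c = cis (2 * pi * (real_vec k \<bullet> x)))"

definition torus_endo :: "complex ^ 'd \<Rightarrow> int ^ 'd ^ 'd \<Rightarrow> complex ^ 'd" where
  "torus_endo z A = (THE w. \<exists>x. z = e2pi x \<and> w = e2pi (transpose (real_mat A) *v x))"

lemma e2pi_nth [simp]: "e2pi x $ i = cis (2 * pi * x $ i)"
  by (simp add: e2pi_def)

lemma e2pi_add: "e2pi (x + y) = e2pi x * e2pi y"
  by (simp add: vec_eq_iff cis_mult algebra_simps)

lemma cis_int [simp]: "cis (2 * pi * real_of_int m) = 1"
  using cis_multiple_2pi[of "real_of_int m"] by simp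

lemma e2pi_real_vec [simp]: "e2pi (real_vec k) = 1"
  by (simp add: vec_eq_iff real_vec_def)

lemma e2pi_in_torus [simp]: "e2pi x \<in> torus"
  by (simp add: torus_def)

lemma torus_e2piE:
  assumes "z \<in> torus"
  obtains x where "z = e2pi x"
proof
  show "z = e2pi (\<chi> i. Arg (z $ i) / (2 * pi))"
    using assms by (auto simp: vec_eq_iff torus_def cis_Arg_unique intro!: complex_eqI)
      (metis Arg_eq_0 cis_Arg norm_eq_zero sgn_eq zero_neq_one div_by_1 of_real_1 cis.simps)+
qed

lemma e2pi_eqD:
  assumes "e2pi x = e2pi y"
  obtains k where "x = y + real_vec k"
proof -
  have "\<exists>m::int. x $ i = y $ i + of_int m" for i
  proof -
    have "cis (2 * pi * x $ i) = cis (2 * pi * y $ i)"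
      using assms by (metis e2pi_nth)
    then have "cis (2 * pi * x $ i - 2 * pi * y $ i) = 1"
      by (simp flip: cis_divide)
    then have "cos (2 * pi * (x $ i - y $ i)) = 1"
      by (simp add: complex_eq_iff algebra_simps)
    then obtain m :: int where "2 * pi * (x $ i - y $ i) = of_int m * 2 * pi"
      using cos_one_2pi_int by blast
    then have "x $ i - y $ i = of_int m" by simp
    then show ?thesis by (intro exI[of _ m]) simp
  qed
  then obtain m where "\<And>i. x $ i = y $ i + of_int (m i)" by metis
  then have "x = y + real_vec (\<chi> i. m i)" by (simp add: vec_eq_iff real_vec_def)
  then show ?thesis using that by blast
qed

lemma real_vec_inner: "real_vec k \<bullet> real_vec l = real_of_int (\<Sum>i\<in>UNIV. k $ i * l $ i)"
  by (simp add: inner_vec_def real_vec_def)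

lemma transpose_real_mat_real_vec:
  "transpose (real_mat A) *v real_vec k = real_vec (transpose A *v k)"
  by (simp add: vec_eq_iff real_vec_def transpose_def matrix_vector_mult_def)

lemma torus_char_e2pi: "torus_char (e2pi x) k = cis (2 * pi * (real_vec k \<bullet> x))"
  unfolding torus_char_def
proof (rule the_equality)
  fix c assume "\<exists>y. e2pi x = e2pi y \<and> c = cis (2 * pi * (real_vec k \<bullet> y))"
  then obtain y where y: "e2pi x = e2pi y" "c = cis (2 * pi * (real_vec k \<bullet> y))" by blast
  obtain l where "x = y + real_vec l" using e2pi_eqD y(1) by blast
  then have "cis (2 * pi * (real_vec k \<bullet> x)) = c"
    by (simp add: y(2) inner_add_right real_vec_inner distrib_left flip: cis_mult del: of_int_sum)
  then show "c = cis (2 * pi * (real_vec k \<bullet> x))" by simp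
qed auto

lemma torus_endo_e2pi: "torus_endo (e2pi x) A = e2pi (transpose (real_mat A) *v x)"
  unfolding torus_endo_def
proof (rule the_equality)
  fix w assume "\<exists>y. e2pi x = e2pi y \<and> w = e2pi (transpose (real_mat A) *v y)"
  then obtain y where y: "e2pi x = e2pi y" "w = e2pi (transpose (real_mat A) *v y)" by blast
  obtain l where "x = y + real_vec l" using e2pi_eqD y(1) by blast
  then show "w = e2pi (transpose (real_mat A) *v x)"
    by (simp add: y(2) matrix_vector_right_distrib e2pi_add transpose_real_mat_real_vec
        del: transpose_matrix_vector)
qed auto

definition is_torus_haar :: "(complex ^ 'd) measure \<Rightarrow> bool" where
  "is_torus_haar M \<longleftrightarrow>
     space M = torus \<and> sets M = sets (restrict_space borel torus) \<and> emeasure M torus = 1 \<and>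
     (\<forall>w\<in>torus. \<forall>E\<in>sets M. emeasure M ((\<lambda>z. w * z) ` E) = emeasure M E)"

text \<open>Existence and uniqueness are shown in \<open>is_torus_haar_torus_haar\<close> and
  \<open>torus_haar_unique\<close> below.\<close>

definition torus_haar :: "(complex ^ 'd) measure" where
  "torus_haar = (THE M. is_torus_haar M)"

definition unit_cube :: "(real ^ 'd) set" where
  "unit_cube = {x. \<forall>i. 0 \<le> x $ i \<and> x $ i < 1}"

lemma unit_cube_translates: "\<exists>!k. x - real_vec k \<in> unit_cube"
proof (rule ex1I[of _ "\<chi> i. \<lfloor>x $ i\<rfloor>"])
  show "x - real_vec (\<chi> i. \<lfloor>x $ i\<rfloor>) \<in> unit_cube"
    by (auto simp: unit_cube_def real_vec_def) linarith
  fix k assume "x - real_vec k \<in> unit_cube"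
  then have "\<lfloor>x $ i\<rfloor> = k $ i" for i
    by (auto simp: unit_cube_def real_vec_def floor_eq_iff dest!: spec[of _ i])
  then show "k = (\<chi> i. \<lfloor>x $ i\<rfloor>)" by (simp add: vec_eq_iff)
qed

lemma continuous_e2pi: "continuous_on S e2pi"
  unfolding e2pi_def by (intro continuous_on_vec_lambda continuous_intros)

lemma borel_e2pi [measurable]: "e2pi \<in> borel_measurable borel"
  by (intro borel_measurable_continuous_onI continuous_e2pi)

lemma borel_unit_cube [measurable]: "unit_cube \<in> sets (borel :: (real ^ 'd) measure)"
proof -
  have [measurable]: "(\<lambda>x::real^'d. x $ i) \<in> borel_measurable borel" for i
    by (intro borel_measurable_continuous_onI continuous_intros)
  have "unit_cube = (\<Inter>i. {x::real^'d. 0 \<le> x $ i \<and> x $ i < 1})"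
    by (auto simp: unit_cube_def)
  also have "\<dots> \<in> sets borel"
    by (intro sets.finite_INT) auto
  finally show ?thesis .
qed

lemma emeasure_unit_cube: "emeasure lborel (unit_cube :: (real ^ 'd) set) = 1"
proof -
  have "box 0 1 \<subseteq> (unit_cube :: (real ^ 'd) set)" "unit_cube \<subseteq> (cbox 0 1 :: (real ^ 'd) set)"
    by (auto simp: unit_cube_def mem_box_cart less_imp_le)
  moreover have "(\<Prod>b\<in>Basis. ((1 :: real ^ 'd) - 0) \<bullet> b) = 1"
    by (intro prod.neutral) (auto simp: Basis_vec_def inner_axis)
  then have "emeasure lborel (box 0 (1 :: real ^ 'd)) = 1" "emeasure lborel (cbox 0 (1 :: real ^ 'd)) = 1"
    by (auto simp: emeasure_lborel_box_eq emeasure_lborel_cbox_eq Basis_vec_def inner_axis)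
  ultimately show ?thesis
    by (metis antisym borel_unit_cube emeasure_mono lborelD sets_lborel borel_closed closed_cbox)
qed

lemma emeasure_lborel_translate:
  fixes S :: "(real ^ 'd) set"
  assumes "S \<in> sets borel"
  shows "emeasure lborel ((\<lambda>x. a + x) -` S) = emeasure lborel S"
proof -
  have "emeasure lborel S = emeasure (distr lborel borel ((+) a)) S"
    by (simp add: lborel_distr_plus)
  also have "\<dots> = emeasure lborel ((\<lambda>x. a + x) -` S)"
    using assms by (subst emeasure_distr) auto
  finally show ?thesis by simp
qed

lemma emeasure_unit_cube_periodic:
  fixes B :: "(real ^ 'd) set"
  assumes [measurable]: "B \<in> sets borel" and per: "\<And>k x. x + real_vec k \<in> B \<longleftrightarrow> x \<in> B"
  shows "emeasure lborel (unit_cube \<inter> (\<lambda>x. a + x) -` B) = emeasure lborel (unit_cube \<inter> B)"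
proof -
  define P where "P = (\<lambda>x. x - a) -` (unit_cube :: (real ^ 'd) set)"
  have [measurable]: "P \<in> sets borel"
    unfolding P_def by (rule measurable_sets_borel[OF _ borel_unit_cube]) measurable
  have tr [measurable]: "(\<lambda>x. b + x) -` S \<in> sets borel" if "S \<in> sets borel" for b and S :: "(real ^ 'd) set"
    by (rule measurable_sets_borel[OF _ that]) measurable
  have "unit_cube \<inter> (\<lambda>x. a + x) -` B = (\<lambda>x. a + x) -` (P \<inter> B)"
    by (auto simp: P_def)
  then have "emeasure lborel (unit_cube \<inter> (\<lambda>x. a + x) -` B) = emeasure lborel (P \<inter> B)"
    using emeasure_lborel_translate[of "P \<inter> B" a] by simp
  also have "P \<inter> B = (\<Union>k. (P \<inter> B) \<inter> (\<lambda>x. - real_vec k + x) -` unit_cube)"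
    using unit_cube_translates by fastforce
  also have "emeasure lborel \<dots> =
      (\<integral>\<^sup>+ k. emeasure lborel ((P \<inter> B) \<inter> (\<lambda>x. - real_vec k + x) -` unit_cube) \<partial>count_space UNIV)"
  proof (rule emeasure_UN_countable)
    show "disjoint_family_on (\<lambda>k. (P \<inter> B) \<inter> (\<lambda>x. - real_vec k + x) -` unit_cube) UNIV"
      using unit_cube_translates by (fastforce simp: disjoint_family_on_def)
  qed auto
  also have "\<dots> = (\<integral>\<^sup>+ k. emeasure lborel ((\<lambda>x. real_vec k + x) -` P \<inter> (unit_cube \<inter> B)) \<partial>count_space UNIV)"
  proof (rule nn_integral_cong)
    fix k :: "int ^ 'd"
    have "emeasure lborel ((P \<inter> B) \<inter> (\<lambda>x. - real_vec k + x) -` unit_cube) =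
          emeasure lborel ((\<lambda>x. real_vec k + x) -` ((P \<inter> B) \<inter> (\<lambda>x. - real_vec k + x) -` unit_cube))"
      by (rule emeasure_lborel_translate[symmetric]) auto
    also have "(\<lambda>x. real_vec k + x) -` ((P \<inter> B) \<inter> (\<lambda>x. - real_vec k + x) -` unit_cube) =
          (\<lambda>x. real_vec k + x) -` P \<inter> (unit_cube \<inter> B)"
      using per by (auto simp: add.commute)
    finally show "emeasure lborel ((P \<inter> B) \<inter> (\<lambda>x. - real_vec k + x) -` unit_cube) =
      emeasure lborel ((\<lambda>x. real_vec k + x) -` P \<inter> (unit_cube \<inter> B))" .
  qed
  also have "\<dots> = emeasure lborel (\<Union>k. (\<lambda>x. real_vec k + x) -` P \<inter> (unit_cube \<inter> B))"
  proof (rule emeasure_UN_countable[symmetric])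
    have inj: "k = l" if "real_vec k + x \<in> P" "real_vec l + x \<in> P" for k l x
    proof -
      have neg: "real_vec (- m) = - real_vec m" for m :: "int ^ 'd"
        by (simp add: real_vec_def vec_eq_iff)
      have "x - a - real_vec (- k) \<in> unit_cube" "x - a - real_vec (- l) \<in> unit_cube"
        using that by (auto simp: P_def neg algebra_simps)
      then have "- k = - l" using unit_cube_translates by blast
      then show ?thesis by simp
    qed
    then show "disjoint_family_on (\<lambda>k. (\<lambda>x. real_vec k + x) -` P \<inter> (unit_cube \<inter> B)) UNIV"
      by (auto simp: disjoint_family_on_def)
  qed auto
  also have "(\<Union>k. (\<lambda>x. real_vec k + x) -` P \<inter> (unit_cube \<inter> B)) = unit_cube \<inter> B"
  proof -
    have "\<exists>k. real_vec k + x \<in> P" for x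
    proof -
      obtain k where "x - a - real_vec k \<in> unit_cube" using unit_cube_translates by blast
      then have "real_vec (- k) + x \<in> P"
        by (simp add: P_def real_vec_def vec_eq_iff algebra_simps unit_cube_def)
      then show ?thesis by blast
    qed
    then show ?thesis by auto
  qed
  finally show ?thesis .
qed

lemma torus_closed: "closed (torus :: (complex ^ 'd) set)"
proof -
  have "torus = (\<Inter>i. {z :: complex ^ 'd. norm (z $ i) = 1})" by (auto simp: torus_def)
  moreover have "closed {z :: complex ^ 'd. norm (z $ i) = 1}" for i
    by (intro closed_Collect_eq continuous_intros)
  ultimately show ?thesis by (metis closed_INT)
qed

lemma sets_torus: "E \<in> sets (restrict_space borel torus) \<longleftrightarrow> E \<in> sets borel \<and> E \<subseteq> torus"
  by (subst sets_restrict_space_iff) (auto intro: borel_closed torus_closed)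

lemma torus_mult [simp]: "w \<in> torus \<Longrightarrow> z \<in> torus \<Longrightarrow> w * z \<in> torus"
  by (simp add: torus_def norm_mult)

lemma borel_vec_times:
  "(\<lambda>p. fst p * snd p :: complex ^ 'd) \<in> borel_measurable (borel \<Otimes>\<^sub>M borel)"
proof -
  have "continuous_on UNIV (\<lambda>p. (\<chi> i. fst p $ i * snd p $ i) :: complex ^ 'd)"
    by (intro continuous_on_vec_lambda continuous_intros)
  then show ?thesis
    by (simp add: borel_prod times_vec_def borel_measurable_continuous_onI)
qed

lemma torus_image_mult:
  assumes "w * w' = 1" "w \<in> torus" "E \<subseteq> torus"
  shows "(\<lambda>z. w * z) ` E = {z. w' * z \<in> E}"
proof -
  have "w * (w' * z) = z" "w' * (w * z) = z" for z
    using assms(1) by (metis mult.assoc mult.commute mult_1)+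
  then show ?thesis by (auto simp: image_iff) metis
qed

lemma torus_inverseE:
  assumes "w \<in> torus"
  obtains w' where "w' \<in> torus" "w * w' = 1"
proof -
  obtain x where "w = e2pi x" using torus_e2piE assms by blast
  moreover have "e2pi x * e2pi (- x) = 1"
    by (simp add: vec_eq_iff cis_mult)
  ultimately show ?thesis using that e2pi_in_torus by blast
qed

definition cube_torus :: "(complex ^ 'd) measure" where
  "cube_torus = distr (restrict_space lborel unit_cube) (restrict_space borel torus) e2pi"

lemma emeasure_cube_torus:
  assumes "E \<in> sets (restrict_space borel torus)"
  shows "emeasure cube_torus E = emeasure lborel (unit_cube \<inter> e2pi -` E)"
proof -
  have m: "e2pi \<in> restrict_space lborel unit_cube \<rightarrow>\<^sub>M restrict_space borel torus"
    by (intro measurable_restrict_space2 measurable_restrict_space1) auto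
  show ?thesis
    unfolding cube_torus_def using assms
    by (subst emeasure_distr[OF m], assumption, subst emeasure_restrict_space)
      (auto simp: space_restrict_space Int_commute)
qed

lemma is_torus_haar_cube_torus: "is_torus_haar (cube_torus :: (complex ^ 'd) measure)"
  unfolding is_torus_haar_def
proof (intro conjI ballI)
  show sp: "space (cube_torus :: (complex ^ 'd) measure) = torus"
    and st: "sets (cube_torus :: (complex ^ 'd) measure) = sets (restrict_space borel torus)"
    by (auto simp: cube_torus_def space_restrict_space)
  have "(torus :: (complex ^ 'd) set) \<in> sets (restrict_space borel torus)"
    by (auto simp: sets_torus torus_closed borel_closed)
  moreover have "unit_cube \<inter> e2pi -` torus = (unit_cube :: (real ^ 'd) set)" by auto
  ultimately show "emeasure cube_torus (torus :: (complex ^ 'd) set) = 1"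
    by (simp add: emeasure_cube_torus emeasure_unit_cube)
  fix w :: "complex ^ 'd" and E :: "(complex ^ 'd) set"
  assume w: "w \<in> torus" and "E \<in> sets cube_torus"
  then have E: "E \<in> sets (restrict_space borel torus)" "E \<in> sets borel" "E \<subseteq> torus"
    by (simp_all add: st sets_torus)
  obtain a where a: "w = e2pi a" using torus_e2piE w by blast
  have wa: "w * e2pi (- a) = 1" by (simp add: vec_eq_iff cis_mult a)
  have im: "(\<lambda>z. w * z) ` E = {z. e2pi (- a) * z \<in> E}"
    using torus_image_mult[OF wa w E(3)] .
  have "(\<lambda>z. \<chi> i. e2pi (- a) $ i * z $ i) \<in> borel_measurable borel"
    by (intro borel_measurable_continuous_onI continuous_on_vec_lambda continuous_intros)
  then have "(\<lambda>z. e2pi (- a) * z) \<in> borel_measurable borel"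
    by (simp add: times_vec_def)
  from measurable_sets_borel[OF this E(2)] have "(\<lambda>z. w * z) ` E \<in> sets borel"
    by (simp add: im vimage_def)
  moreover have "(\<lambda>z. w * z) ` E \<subseteq> torus" using E(3) w by auto
  ultimately have "emeasure cube_torus ((\<lambda>z. w * z) ` E) =
      emeasure lborel (unit_cube \<inter> e2pi -` ((\<lambda>z. w * z) ` E))"
    by (simp add: emeasure_cube_torus sets_torus)
  also have "e2pi -` ((\<lambda>z. w * z) ` E) = (\<lambda>x. - a + x) -` (e2pi -` E)"
    by (auto simp: im simp flip: e2pi_add)
  also have "emeasure lborel (unit_cube \<inter> \<dots>) = emeasure lborel (unit_cube \<inter> e2pi -` E)"
    by (rule emeasure_unit_cube_periodic)
      (auto intro: measurable_sets_borel[OF borel_e2pi E(2)] simp: e2pi_add)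
  finally show "emeasure cube_torus ((\<lambda>z. w * z) ` E) = emeasure cube_torus E"
    by (simp add: emeasure_cube_torus E)
qed

lemma is_torus_haar_integral:
  assumes M: "is_torus_haar M" and w: "w \<in> torus" and E: "E \<in> sets M"
  shows "(\<integral>\<^sup>+ z. indicator E (w * z) \<partial>M) = emeasure M E"
proof -
  have sp: "space M = torus" and Et: "E \<subseteq> torus" "E \<in> sets borel"
    using M E by (auto simp: is_torus_haar_def sets_torus)
  obtain w' where w': "w' \<in> torus" "w * w' = 1" using torus_inverseE w by blast
  have im: "(\<lambda>z. w' * z) ` E = {z. w * z \<in> E}"
    using w' Et(1) by (intro torus_image_mult) (auto simp: mult.commute)
  have "(\<lambda>z. \<chi> i. w $ i * z $ i) \<in> borel_measurable borel"
    by (intro borel_measurable_continuous_onI continuous_on_vec_lambda continuous_intros)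
  then have "(\<lambda>z. w * z) \<in> borel_measurable borel"
    by (simp add: times_vec_def)
  from measurable_sets_borel[OF this Et(2)] have "(\<lambda>z. w' * z) ` E \<in> sets borel"
    by (simp add: im vimage_def)
  moreover have "(\<lambda>z. w' * z) ` E \<subseteq> torus" using Et(1) w' by auto
  ultimately have s: "(\<lambda>z. w' * z) ` E \<in> sets M"
    using M by (auto simp: is_torus_haar_def sets_torus)
  have "(\<integral>\<^sup>+ z. indicator E (w * z) \<partial>M) = (\<integral>\<^sup>+ z. indicator ((\<lambda>z. w' * z) ` E) z \<partial>M)"
    by (simp add: im indicator_def)
  also have "\<dots> = emeasure M ((\<lambda>z. w' * z) ` E)" using s by simp
  also have "\<dots> = emeasure M E" using M w' E by (simp add: is_torus_haar_def)
  finally show ?thesis .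
qed

lemma torus_haar_unique:
  assumes M: "is_torus_haar M" and N: "is_torus_haar N"
  shows "M = N"
proof (rule measure_eqI)
  have sM: "space M = torus" "sets M = sets (restrict_space borel torus)" "emeasure M torus = 1"
    and sN: "space N = torus" "sets N = sets (restrict_space borel torus)" "emeasure N torus = 1"
    using M N by (auto simp: is_torus_haar_def)
  then show "sets M = sets N" by simp
  interpret M: finite_measure M by standard (simp add: sM)
  interpret N: finite_measure N by standard (simp add: sN)
  interpret pair_sigma_finite M N ..
  fix E assume E: "E \<in> sets M"
  then have Eb: "E \<in> sets borel" and EN: "E \<in> sets N" by (simp_all add: sM sN sets_torus)
  have idM: "(\<lambda>z. z) \<in> M \<rightarrow>\<^sub>M borel" and idN: "(\<lambda>z. z) \<in> N \<rightarrow>\<^sub>M borel"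
    by (auto simp: measurable_def sM sN sets_restrict_space)
  have "(\<lambda>p. (fst p, snd p)) \<in> M \<Otimes>\<^sub>M N \<rightarrow>\<^sub>M borel \<Otimes>\<^sub>M borel"
    by (intro measurable_Pair measurable_compose[OF measurable_fst idM] measurable_compose[OF measurable_snd idN])
  from measurable_compose[OF this borel_vec_times]
  have "(\<lambda>p. fst p * snd p) \<in> M \<Otimes>\<^sub>M N \<rightarrow>\<^sub>M borel" by simp
  from measurable_compose[OF this borel_measurable_indicator[OF Eb, where ?'b = ennreal]]
  have meas: "(\<lambda>(x, y). indicator E (x * y) :: ennreal) \<in> borel_measurable (M \<Otimes>\<^sub>M N)"
    by (simp add: case_prod_beta)
  have "emeasure M E = (\<integral>\<^sup>+ y. emeasure M E \<partial>N)" by (simp add: sN)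
  also have "\<dots> = (\<integral>\<^sup>+ y. (\<integral>\<^sup>+ x. indicator E (x * y) \<partial>M) \<partial>N)"
    by (intro nn_integral_cong) (simp add: is_torus_haar_integral[OF M _ E] sN mult.commute)
  also have "\<dots> = (\<integral>\<^sup>+ x. (\<integral>\<^sup>+ y. indicator E (x * y) \<partial>N) \<partial>M)"
    by (rule Fubini'[OF meas])
  also have "\<dots> = (\<integral>\<^sup>+ x. emeasure N E \<partial>M)"
    by (intro nn_integral_cong) (simp add: is_torus_haar_integral[OF N _ EN] sM)
  also have "\<dots> = emeasure N E" by (simp add: sM)
  finally show "emeasure M E = emeasure N E" .
qed

lemma torus_haar_eq: "torus_haar = cube_torus"
  unfolding torus_haar_def
  using is_torus_haar_cube_torus torus_haar_unique by (intro the_equality) auto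

lemma is_torus_haar_torus_haar: "is_torus_haar torus_haar"
  by (simp add: torus_haar_eq is_torus_haar_cube_torus)


section \<open>The solenoid\<close>

definition solenoid :: "int ^ 'd ^ 'd \<Rightarrow> (nat \<Rightarrow> complex ^ 'd) set" where
  "solenoid A = {z. \<forall>n. z n \<in> torus \<and> torus_endo (z (Suc n)) A = z n}"

definition solenoid_shift :: "int ^ 'd ^ 'd \<Rightarrow> (nat \<Rightarrow> complex ^ 'd) \<Rightarrow> (nat \<Rightarrow> complex ^ 'd)" where
  "solenoid_shift A z = case_nat (torus_endo (z 0) A) z"

definition solenoid1 :: "int ^ 'd ^ 'd \<Rightarrow> (nat \<Rightarrow> complex ^ 'd) set" where
  "solenoid1 A = {z \<in> solenoid A. z \<longlonglongrightarrow> 1}"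

definition ihat :: "int ^ 'd ^ 'd \<Rightarrow> real ^ 'd \<Rightarrow> (nat \<Rightarrow> complex ^ 'd)" where
  "ihat A x = (\<lambda>n. e2pi (mat_powi (transpose (real_mat A)) (- int n) *v x))"

text \<open>The sum-over-fibres integral, evaluated on indicator functions of the Borel sets of
  \<open>solenoid1 A\<close> (for the subspace topology of the product topology).\<close>

definition mu_tilde :: "int ^ 'd ^ 'd \<Rightarrow> (nat \<Rightarrow> complex ^ 'd) measure" where
  "mu_tilde A = measure_of (solenoid1 A) (sets (restrict_space borel (solenoid1 A)))
     (\<lambda>E. \<integral>\<^sup>+ z. (\<Sum>\<^sub>\<infinity>w\<in>{w \<in> solenoid1 A. w 0 = z}. indicator E w) \<partial>torus_haar)"


section \<open>The Hilbert space of square integrable functions\<close>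

definition sq_integrable :: "'a measure \<Rightarrow> ('a \<Rightarrow> complex) set" where
  "sq_integrable M = {f \<in> borel_measurable M. integrable M (\<lambda>x. (norm (f x))\<^sup>2)}"

definition ae_eq :: "'a measure \<Rightarrow> (('a \<Rightarrow> complex) \<times> ('a \<Rightarrow> complex)) set" where
  "ae_eq M = {(f, g). f \<in> sq_integrable M \<and> g \<in> sq_integrable M \<and> (AE x in M. f x = g x)}"

definition L2 :: "'a measure \<Rightarrow> ('a \<Rightarrow> complex) set set" where
  "L2 M = sq_integrable M // ae_eq M"

definition L2_class :: "'a measure \<Rightarrow> ('a \<Rightarrow> complex) \<Rightarrow> ('a \<Rightarrow> complex) set" where
  "L2_class M f = ae_eq M `` {f}"

definition L2_add ::
    "'a measure \<Rightarrow> ('a \<Rightarrow> complex) set \<Rightarrow> ('a \<Rightarrow> complex) set \<Rightarrow> ('a \<Rightarrow> complex) set" where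
  "L2_add M X Y = (\<Union>f\<in>X. \<Union>g\<in>Y. L2_class M (\<lambda>x. f x + g x))"

definition L2_scale :: "'a measure \<Rightarrow> complex \<Rightarrow> ('a \<Rightarrow> complex) set \<Rightarrow> ('a \<Rightarrow> complex) set" where
  "L2_scale M c X = (\<Union>f\<in>X. L2_class M (\<lambda>x. c * f x))"

definition L2_inner :: "'a measure \<Rightarrow> ('a \<Rightarrow> complex) set \<Rightarrow> ('a \<Rightarrow> complex) set \<Rightarrow> complex" where
  "L2_inner M X Y = (THE c. \<exists>f\<in>X. \<exists>g\<in>Y. c = (LINT x|M. f x * cnj (g x)))"

definition L2_norm :: "'a measure \<Rightarrow> ('a \<Rightarrow> complex) set \<Rightarrow> real" where
  "L2_norm M X = sqrt (Re (L2_inner M X X))"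

text \<open>The map on classes induced by a map on functions.\<close>

definition L2_lift :: "'b measure \<Rightarrow> (('a \<Rightarrow> complex) \<Rightarrow> ('b \<Rightarrow> complex)) \<Rightarrow>
    ('a \<Rightarrow> complex) set \<Rightarrow> ('b \<Rightarrow> complex) set" where
  "L2_lift N T X = (\<Union>f\<in>X. L2_class N (T f))"

definition L2_linear_bij ::
    "'a measure \<Rightarrow> 'b measure \<Rightarrow> (('a \<Rightarrow> complex) set \<Rightarrow> ('b \<Rightarrow> complex) set) \<Rightarrow> bool" where
  "L2_linear_bij M N V \<longleftrightarrow> bij_betw V (L2 M) (L2 N) \<and>
     (\<forall>X\<in>L2 M. \<forall>Y\<in>L2 M. V (L2_add M X Y) = L2_add N (V X) (V Y)) \<and>
     (\<forall>c. \<forall>X\<in>L2 M. V (L2_scale M c X) = L2_scale N c (V X))"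

definition L2_isometric_iso ::
    "'a measure \<Rightarrow> 'b measure \<Rightarrow> (('a \<Rightarrow> complex) set \<Rightarrow> ('b \<Rightarrow> complex) set) \<Rightarrow> bool" where
  "L2_isometric_iso M N V \<longleftrightarrow>
     L2_linear_bij M N V \<and> (\<forall>X\<in>L2 M. L2_norm N (V X) = L2_norm M X)"

definition L2_unitary :: "'a measure \<Rightarrow> (('a \<Rightarrow> complex) set \<Rightarrow> ('a \<Rightarrow> complex) set) \<Rightarrow> bool" where
  "L2_unitary M V \<longleftrightarrow>
     L2_linear_bij M M V \<and> (\<forall>X\<in>L2 M. \<forall>Y\<in>L2 M. L2_inner M (V X) (V Y) = L2_inner M X Y)"


section \<open>The operators\<close>

definition T_tilde :: "int ^ 'd ^ 'd \<Rightarrow> int ^ 'd \<Rightarrow>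
    ((nat \<Rightarrow> complex ^ 'd) \<Rightarrow> complex) set \<Rightarrow> ((nat \<Rightarrow> complex ^ 'd) \<Rightarrow> complex) set" where
  "T_tilde A k = L2_lift (mu_tilde A) (\<lambda>f z. torus_char (z 0) k * f z)"

definition U_tilde :: "int ^ 'd ^ 'd \<Rightarrow>
    ((nat \<Rightarrow> complex ^ 'd) \<Rightarrow> complex) set \<Rightarrow> ((nat \<Rightarrow> complex ^ 'd) \<Rightarrow> complex) set" where
  "U_tilde A = L2_lift (mu_tilde A)
     (\<lambda>f z. complex_of_real (sqrt \<bar>real_of_int (det A)\<bar>) * f (solenoid_shift A z))"

definition T_hat :: "int ^ 'd \<Rightarrow> (real ^ 'd \<Rightarrow> complex) set \<Rightarrow> (real ^ 'd \<Rightarrow> complex) set" where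
  "T_hat k = L2_lift lborel (\<lambda>h x. cis (2 * pi * (real_vec k \<bullet> x)) * h x)"

definition U_hat :: "int ^ 'd ^ 'd \<Rightarrow> (real ^ 'd \<Rightarrow> complex) set \<Rightarrow> (real ^ 'd \<Rightarrow> complex) set" where
  "U_hat A = L2_lift lborel
     (\<lambda>h x. complex_of_real (sqrt \<bar>real_of_int (det A)\<bar>) * h (transpose (real_mat A) *v x))"

definition W_op :: "int ^ 'd ^ 'd \<Rightarrow>
    (real ^ 'd \<Rightarrow> complex) set \<Rightarrow> ((nat \<Rightarrow> complex ^ 'd) \<Rightarrow> complex) set" where
  "W_op A = L2_lift (mu_tilde A) (\<lambda>f. f \<circ> inv_into UNIV (ihat A))"

definition measure_preserving_iso :: "'a measure \<Rightarrow> 'b measure \<Rightarrow> ('a \<Rightarrow> 'b) \<Rightarrow> bool" where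
  "measure_preserving_iso M N \<phi> \<longleftrightarrow>
     bij_betw \<phi> (space M) (space N) \<and>
     \<phi> \<in> measurable M N \<and> inv_into (space M) \<phi> \<in> measurable N M \<and>
     (\<forall>E\<in>sets N. emeasure M (\<phi> -` E \<inter> space M) = emeasure N E)"


section \<open>The group\<close>

definition Z_inv :: "int ^ 'd ^ 'd \<Rightarrow> (real ^ 'd) set" where
  "Z_inv A = {mat_powi (real_mat A) (- int j) *v real_vec k | j k. True}"

definition G_A :: "int ^ 'd ^ 'd \<Rightarrow> (int \<times> (real ^ 'd)) monoid" where
  "G_A A = \<lparr>carrier = UNIV \<times> Z_inv A,
     mult = (\<lambda>(j, b) (k, c). (j + k, mat_powi (real_mat A) j *v c + b)),
     one = (0, 0)\<rparr>"

text \<open>Unitary representations on \<open>L2 M\<close>; elements of \<open>BijGroup\<close> are functions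
  restricted to \<open>L2 M\<close>.\<close>

definition unitary_rep :: "('g, 'c) monoid_scheme \<Rightarrow> 'a measure \<Rightarrow>
    ('g \<Rightarrow> ('a \<Rightarrow> complex) set \<Rightarrow> ('a \<Rightarrow> complex) set) \<Rightarrow> bool" where
  "unitary_rep G M \<pi> \<longleftrightarrow> \<pi> \<in> hom G (BijGroup (L2 M)) \<and> (\<forall>g\<in>carrier G. L2_unitary M (\<pi> g))"

end

theory Submission
  imports Defs "HOL-Computational_Algebra.Fundamental_Theorem_Algebra"
begin

text \<open>
  Everything is transported from \<open>\<real>\<^sup>d\<close> along the map \<^const>\<open>ihat\<close>.  Expansiveness enters through
  \<open>(A\<^sup>T)\<^sup>-\<^sup>n x \<longlonglongrightarrow> 0\<close> for all \<open>x\<close> (lemma \<open>dil_tendsto_0\<close>): a vector is annihilated by a polynomial in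
  \<open>(A\<^sup>T)\<^sup>-\<^sup>1\<close>, whose linear factors either can be cancelled or belong to eigenvalues of modulus less
  than one.  Consequently the values of \<^const>\<open>ihat\<close> converge to \<open>1\<close>; conversely a point of the solenoid that
  converges to \<open>1\<close> has small logarithms from some index on, and these are of the form \<open>(A\<^sup>T)\<^sup>-\<^sup>n x\<close>
  because an integer vector of norm less than one vanishes.  So \<^const>\<open>ihat\<close> is a continuous bijection of \<open>\<real>\<^sup>d\<close> onto
  \<^const>\<open>solenoid1\<close>, and its inverse is Borel because \<open>\<real>\<^sup>d\<close> is a countable union of compact sets.

  The fibre over \<open>e\<^sup>2\<^sup>\<pi>\<^sup>i\<^sup>x\<close> consists of the images of \<open>x + k\<close>, \<open>k \<in> \<int>\<^sup>d\<close>, and Haar measure on the torus is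
  Lebesgue measure on the unit cube.  Integrating the sums over the fibres therefore adds up the
  Lebesgue measures of the pieces of a set in the translates of the cube, and the result is the image
  of Lebesgue measure (lemma \<open>mu_tilde_eq_distr\<close>).  This is the measure preservation of \<^const>\<open>ihat\<close>.

  In the coordinate \<open>x\<close> the shift is \<open>x \<mapsto> A\<^sup>T x\<close>, so it scales the measure by the determinant
  (lemma \<open>emeasure_lborel_vimage_linear\<close>).  All operators in question are weighted compositions
  \<open>f \<mapsto> w \<cdot> f \<circ> \<psi>\<close> in which \<open>\<bar>w\<bar>\<^sup>2\<close> compensates the scaling of the measure by \<open>\<psi>\<close>; these are
  isometric isomorphisms, with inverses of the same kind (locale \<open>balanced_scaling_iso\<close>).  The
  relations between them reduce to identities between the weights, and the formula
  \<open>(j, b) \<mapsto> e\<^sup>2\<^sup>\<pi>\<^sup>i\<^sup>b\<^sup>\<cdot>\<^sup>x \<bar>det A\<bar>\<^sup>j\<^sup>/\<^sup>2 h ((A\<^sup>T)\<^sup>j x)\<close> gives the representation of the whole group \<open>G\<^sub>A\<close>.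
\<close>

section \<open>Powers of a matrix with small spectrum\<close>

lemma perturbed_contraction_tendsto_0:
  fixes x e :: "nat \<Rightarrow> real"
  assumes q: "0 \<le> q" "q < 1" and x: "\<And>n. 0 \<le> x n"
    and rec: "\<And>n. x (Suc n) \<le> q * x n + e n" and e: "e \<longlonglongrightarrow> 0"
  shows "x \<longlonglongrightarrow> 0"
proof (rule LIMSEQ_I)
  fix r :: real assume r: "0 < r"
  \<comment> \<open>Errors below \<open>(1 - q) r / 2\<close>, damped geometrically, add up to at most \<open>r / 2\<close>.\<close>
  define d where "d = (1 - q) * r / 2"
  have "0 < d" using q r by (simp add: d_def)
  then obtain N where N: "\<And>n. n \<ge> N \<Longrightarrow> \<bar>e n\<bar> < d"
    using LIMSEQ_D[OF e] by fastforce
  have bound: "x (m + N) \<le> q ^ m * x N + r / 2" for m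
  proof (induction m)
    case 0
    then show ?case using r by simp
  next
    case (Suc m)
    have "x (Suc m + N) \<le> q * x (m + N) + d"
      using rec[of "m + N"] N[of "m + N"] by fastforce
    also have "\<dots> \<le> q * (q ^ m * x N + r / 2) + d"
      using Suc q by (intro add_right_mono mult_left_mono)
    also have "\<dots> = q ^ Suc m * x N + r / 2"
      by (simp add: d_def field_simps)
    finally show ?case .
  qed
  have "(\<lambda>m. q ^ m * x N) \<longlonglongrightarrow> 0 * x N"
    using q by (intro tendsto_mult LIMSEQ_power_zero tendsto_const) auto
  then obtain M where M: "\<And>m. m \<ge> M \<Longrightarrow> \<bar>q ^ m * x N\<bar> < r / 2"
    using LIMSEQ_D[of _ 0 "r / 2"] r by fastforce
  have "norm (x n - 0) < r" if "n \<ge> M + N" for n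
  proof -
    have "x (n - N + N) < r"
      using bound[of "n - N"] M[of "n - N"] that by fastforce
    then show ?thesis using x[of n] that by simp
  qed
  then show "\<exists>n0. \<forall>n\<ge>n0. norm (x n - 0) < r" by blast
qed

text \<open>The vector \<open>p(M) v\<close>, by Horner's scheme on the coefficients, so that
  the recursion follows \<^const>\<open>pCons\<close> and no powers of matrices are needed.\<close>

definition poly_act :: "complex ^ 'd ^ 'd \<Rightarrow> complex poly \<Rightarrow> complex ^ 'd \<Rightarrow> complex ^ 'd" where
  "poly_act M p v = fold_coeffs (\<lambda>a w. a *s v + M *v w) p 0"

lemma poly_act_0 [simp]: "poly_act M 0 v = 0"
  by (simp add: poly_act_def)

lemma poly_act_pCons [simp]: "poly_act M (pCons a p) v = a *s v + M *v poly_act M p v"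
  by (cases "p = 0 \<and> a = 0") (auto simp: poly_act_def)

lemma poly_act_smult: "poly_act M (smult c p) v = c *s poly_act M p v"
  by (induction p)
    (simp_all add: vec.scale_right_distrib vector_scalar_commute matrix_vector_mult_scaleR)

lemma poly_act_add: "poly_act M (p + q) v = poly_act M p v + poly_act M q v"
  by (induction p q rule: poly_induct2)
    (simp_all add: vec.scale_left_distrib matrix_vector_right_distrib)

lemma poly_act_sum: "poly_act M (\<Sum>i\<in>S. f i) v = (\<Sum>i\<in>S. poly_act M (f i) v)"
  by (induction S rule: infinite_finite_induct) (simp_all add: poly_act_add)

lemma poly_act_monom: "poly_act M (monom c n) v = c *s (((*v) M) ^^ n) v"
  by (induction n) (simp_all add: monom_0 monom_Suc vector_scalar_commute)

lemma poly_act_linear_factor: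
  "poly_act M ([:- l, 1:] * q) v = M *v poly_act M q v - l *s poly_act M q v"
proof -
  have "[:- l, 1:] * q = smult (- l) q + pCons 0 q" by simp
  also have "poly_act M \<dots> v = M *v poly_act M q v - l *s poly_act M q v"
    by (subst poly_act_add) (simp add: poly_act_smult del: smult_minus_left)
  finally show ?thesis .
qed

lemma poly_act_shifted:
  "poly_act M q (M *v v - l *s v) = M *v poly_act M q v - l *s poly_act M q v"
proof (induction q)
  case (pCons a q)
  have "poly_act M (pCons a q) (M *v v - l *s v)
      = a *s (M *v v - l *s v) + M *v (M *v poly_act M q v - l *s poly_act M q v)"
    by (simp add: pCons.IH)
  then show ?case
    by (simp add: matrix_vector_mult_diff_distrib matrix_vector_right_distrib
        vec.scale_right_diff_distrib vec.scale_right_distrib vector_scalar_commute mult.commute)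
qed simp

text \<open>The vectors \<open>v, M v, \<dots>, M\<^sup>d v\<close> are linearly dependent.\<close>

lemma annihilating_poly_exists:
  fixes M :: "complex ^ 'd ^ 'd"
  obtains p where "p \<noteq> 0" "poly_act M p v = 0"
proof -
  define f where "f n = (((*v) M) ^^ n) v" for n
  show ?thesis
  \<comment> \<open>Dependence is a property of the set of these vectors, so a repetition among them is a separate
    case.\<close>
  proof (cases "inj_on f {..CARD('d)}")
    case False
    then obtain i j where ij: "i \<noteq> j" "f i = f j" by (auto simp: inj_on_def)
    have "poly_act M (monom 1 i + monom (-1) j) v = 0"
      using ij by (simp add: poly_act_add poly_act_monom f_def)
    moreover have "coeff (monom 1 i + monom (-1) j :: complex poly) i = 1"
      using ij by simp
    then have "monom 1 i + monom (-1) j \<noteq> (0 :: complex poly)"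
      by (metis coeff_0 zero_neq_one)
    ultimately show ?thesis using that by blast
  next
    case True
    let ?S = "f ` {..CARD('d)}"
    have "\<not> vec.independent ?S"
    proof
      assume "vec.independent ?S"
      then have "card ?S \<le> vec.dim (UNIV :: (complex ^ 'd) set)"
        by (intro vec.independent_card_le_dim) auto
      then show False using True by (simp add: card_image vec_dim_card del: vec.dim_UNIV)
    qed
    then obtain u where u: "\<exists>w\<in>?S. u w \<noteq> 0" "(\<Sum>w\<in>?S. u w *s w) = 0"
      by (auto simp: vec.dependent_finite)
    define p where "p = (\<Sum>i\<le>CARD('d). monom (u (f i)) i)"
    have "poly_act M p v = (\<Sum>i\<le>CARD('d). u (f i) *s f i)"
      by (simp add: p_def poly_act_sum poly_act_monom f_def)
    also have "\<dots> = (\<Sum>w\<in>?S. u w *s w)"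
      using True by (simp add: sum.reindex)
    finally have "poly_act M p v = 0" using u by simp
    moreover obtain i where i: "i \<le> CARD('d)" "u (f i) \<noteq> 0" using u by auto
    have "coeff p i = u (f i)"
      using i by (simp add: p_def coeff_sum)
    with i have "p \<noteq> 0" by auto
    ultimately show ?thesis using that by blast
  qed
qed

text \<open>Induction on the degree of a polynomial annihilating the vector.  A linear factor
  \<open>M - l\<close> whose root is not an eigenvalue is injective and can be cancelled.  If
  \<open>\<bar>l\<bar> < 1\<close>, then \<open>w = (M - l) v\<close> is annihilated by the remaining factors, and
  \<open>M\<^sup>n\<^sup>+\<^sup>1 v = l M\<^sup>n v + M\<^sup>n w\<close> is a contraction perturbed by a null sequence.\<close>

lemma matrix_power_tendsto_0:
  fixes M :: "complex ^ 'd ^ 'd"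
  assumes eig: "\<And>l v. v \<noteq> 0 \<Longrightarrow> M *v v = l *s v \<Longrightarrow> norm l < 1"
  shows "(\<lambda>n. (((*v) M) ^^ n) v) \<longlonglongrightarrow> 0"
proof -
  have "(\<lambda>n. (((*v) M) ^^ n) v) \<longlonglongrightarrow> 0" if "p \<noteq> 0" "poly_act M p v = 0" for p v
    using that
  proof (induction "degree p" arbitrary: p v)
    case 0
    then obtain a where "p = [:a:]" "a \<noteq> 0" by (metis degree_eq_zeroE pCons_0_0)
    with 0 have "v = 0" by simp
    moreover have "(((*v) M) ^^ n) 0 = 0" for n by (induction n) simp_all
    ultimately show ?case by simp
  next
    case (Suc k)
    then have "\<not> constant (poly p)" by (simp add: constant_degree)
    then obtain l where "poly p l = 0" using fundamental_theorem_of_algebra by blast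
    then obtain q where q: "p = [:- l, 1:] * q" by (metis poly_eq_0_iff_dvd dvdE)
    have "q \<noteq> 0" using q Suc.prems by auto
    then have deg: "k = degree q" using q Suc.hyps(2) by (simp add: degree_mult_eq del: mult_pCons_left)
    let ?w = "M *v v - l *s v"
    have eq: "M *v poly_act M q v - l *s poly_act M q v = 0"
      using Suc.prems(2) unfolding q poly_act_linear_factor .
    show ?case
    proof (cases "poly_act M q v = 0")
      case True
      then show ?thesis using Suc.hyps(1)[OF deg \<open>q \<noteq> 0\<close>] by blast
    next
      case False
      then have l: "norm l < 1" using eig eq by auto
      have w: "(\<lambda>n. (((*v) M) ^^ n) ?w) \<longlonglongrightarrow> 0"
        using Suc.hyps(1)[OF deg \<open>q \<noteq> 0\<close>] eq by (simp add: poly_act_shifted)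
      have iter: "(((*v) M) ^^ Suc n) v = l *s (((*v) M) ^^ n) v + (((*v) M) ^^ n) ?w" for n
      proof (induction n)
        case (Suc n)
        have "(((*v) M) ^^ Suc (Suc n)) v = M *v (((*v) M) ^^ Suc n) v" by simp
        also have "\<dots> = l *s (((*v) M) ^^ Suc n) v + (((*v) M) ^^ Suc n) ?w"
          by (subst Suc) (simp add: matrix_vector_right_distrib vector_scalar_commute)
        finally show ?case .
      qed simp
      have "norm (c *s x) = norm c * norm x" for c and x :: "complex ^ 'd"
        by (simp add: norm_vec_def norm_mult L2_set_right_distrib)
      then have "norm ((((*v) M) ^^ Suc n) v)
          \<le> norm l * norm ((((*v) M) ^^ n) v) + norm ((((*v) M) ^^ n) ?w)" for n
        unfolding iter using norm_triangle_ineq by metis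
      from perturbed_contraction_tendsto_0[OF _ l _ this tendsto_norm_zero[OF w]]
      show ?thesis by (simp add: tendsto_norm_zero_iff)
    qed
  qed
  then show ?thesis using annihilating_poly_exists[of M v] by metis
qed


section \<open>Integer powers of an invertible matrix\<close>

lemma matrix_inv_cancel:
  fixes M :: "real ^ 'd ^ 'd"
  assumes "invertible M"
  shows matrix_inv_right: "M ** matrix_inv M = mat 1"
    and matrix_inv_left: "matrix_inv M ** M = mat 1"
  using someI_ex[OF assms[unfolded invertible_def]] by (simp_all add: matrix_inv_def)

lemma matrix_inv_transpose:
  fixes M :: "real ^ 'd ^ 'd"
  assumes "invertible M"
  shows "matrix_inv (transpose M) = transpose (matrix_inv M)"
proof -
  have "invertible (transpose M)" using assms by (simp add: invertible_det_nz)
  moreover have "transpose (matrix_inv M) ** transpose M = mat 1"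
    by (metis assms matrix_inv_right matrix_transpose_mul transpose_mat)
  ultimately show ?thesis
    by (metis matrix_inv_right matrix_mul_assoc matrix_mul_lid matrix_mul_rid)
qed

lemma mat_pow_Suc_right: "mat_pow M (Suc n) = mat_pow M n ** M"
  by (induction n) (simp_all add: matrix_mul_assoc)

lemma mat_pow_transpose: "mat_pow (transpose M) n = transpose (mat_pow M n)"
proof (induction n)
  case (Suc n)
  then show ?case by (metis mat_pow.simps(2) mat_pow_Suc_right matrix_transpose_mul)
qed simp

lemma mat_powi_transpose:
  assumes "invertible M"
  shows "mat_powi (transpose M) j = transpose (mat_powi M j)"
  using assms by (simp add: mat_powi_def matrix_inv_transpose mat_pow_transpose)

lemma mat_powi_0 [simp]: "mat_powi M 0 = mat 1"
  by (simp add: mat_powi_def)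

lemma mat_powi_1 [simp]: "mat_powi M 1 = M"
  by (simp add: mat_powi_def)

lemma mat_powi_succ:
  assumes "invertible M"
  shows "mat_powi M (j + 1) = M ** mat_powi M j"
proof (cases "j \<ge> 0")
  case True
  then show ?thesis by (simp add: mat_powi_def nat_add_distrib)
next
  case False
  then obtain n where j: "j = - int (Suc n)" by (metis int_cases not_le_imp_less negD)
  have "mat_powi M (j + 1) = mat_pow (matrix_inv M) n"
    by (cases n) (simp_all add: j mat_powi_def nat_add_distrib)
  moreover have "mat_powi M j = matrix_inv M ** mat_pow (matrix_inv M) n"
    by (simp add: j mat_powi_def nat_add_distrib)
  ultimately show ?thesis
    using assms by (simp add: matrix_mul_assoc matrix_inv_right)
qed

lemma mat_powi_add:
  assumes M: "invertible M"
  shows "mat_powi M (i + j) = mat_powi M i ** mat_powi M j"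
proof (induction i rule: int_induct[of _ 0])
  case (step1 i)
  have "mat_powi M (i + 1 + j) = M ** mat_powi M (i + j)"
    using mat_powi_succ[OF M, of "i + j"] by (simp add: ac_simps)
  with step1 show ?case by (simp add: mat_powi_succ[OF M] matrix_mul_assoc)
next
  case (step2 i)
  have "M ** mat_powi M (i - 1 + j) = mat_powi M (i + j)"
    using mat_powi_succ[OF M, of "i - 1 + j"] by (simp add: ac_simps)
  also have "\<dots> = M ** (mat_powi M (i - 1) ** mat_powi M j)"
    using step2 mat_powi_succ[OF M, of "i - 1"] by (simp add: matrix_mul_assoc)
  finally show ?case
    by (metis M matrix_inv_left matrix_mul_assoc matrix_mul_lid)
qed simp

lemma det_mat_powi:
  fixes M :: "real ^ 'd ^ 'd"
  assumes M: "invertible M"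
  shows "det (mat_powi M j) = det M powi j"
proof -
  have nz: "det M \<noteq> 0" using M by (simp add: invertible_det_nz)
  show ?thesis
  proof (induction j rule: int_induct[of _ 0])
    case (step1 j)
    then show ?case using nz by (simp add: mat_powi_succ[OF M] det_mul power_int_add)
  next
    case (step2 j)
    have "det M * det (mat_powi M (j - 1)) = det (mat_powi M j)"
      using mat_powi_succ[OF M, of "j - 1"] by (simp add: det_mul)
    also have "\<dots> = det M * det M powi (j - 1)"
      using step2 nz by (simp add: power_int_diff)
    finally show ?case using nz by simp
  qed simp
qed


section \<open>The dual action of an expansive matrix\<close>

lemma det_map_matrix_of_int: "det (map_matrix of_int A) = of_int (det A)"
  by (simp add: det_def sum_distrib_left)

lemma expansive_det_nz:
  assumes "expansive A"
  shows "det A \<noteq> 0"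
proof
  assume "det A = 0"
  then have "\<not> invertible (map_matrix of_int A :: complex ^ 'a ^ 'a)"
    by (simp add: invertible_det_nz det_map_matrix_of_int)
  then obtain v :: "complex ^ 'a" where "v \<noteq> 0" "map_matrix of_int A *v v = 0"
    by (metis invertible_left_inverse matrix_left_invertible_ker)
  then have "map_matrix of_int A *v v = 0 *s v" by simp
  with assms \<open>v \<noteq> 0\<close> show False by (fastforce simp: expansive_def)
qed

text \<open>A matrix and its transpose have the same eigenvalues, because
  \<open>det (A\<^sup>T - l) = det (A - l)\<close>.\<close>

lemma expansive_transpose_eigenvalue:
  assumes A: "expansive A" and v: "v \<noteq> 0" "transpose (map_matrix of_int A) *v v = l *s v"
  shows "norm (l :: complex) > 1"
proof -
  define C :: "complex ^ 'a ^ 'a" where "C = map_matrix of_int A - mat l"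
  have mat: "mat l *v w = l *s w" for w :: "complex ^ 'a"
    by (simp add: vec_eq_iff matrix_vector_mult_def mat_def if_distrib[of "\<lambda>x. x * _"] cong: if_cong)
  have "transpose C = transpose (map_matrix of_int A) - mat l"
    by (simp add: C_def vec_eq_iff transpose_def mat_def)
  then have "transpose C *v v = 0"
    using v(2) by (simp add: matrix_vector_mult_diff_rdistrib mat del: transpose_matrix_vector)
  then have "det (transpose C) = 0"
    using v(1) by (metis invertible_det_nz invertible_left_inverse matrix_left_invertible_ker)
  then obtain w where w: "w \<noteq> 0" "C *v w = 0"
    by (metis det_transpose invertible_det_nz invertible_left_inverse matrix_left_invertible_ker)
  then have "map_matrix of_int A *v w = l *s w"
    by (simp add: C_def matrix_vector_mult_diff_rdistrib mat)
  with A w(1) show ?thesis by (auto simp: expansive_def)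
qed

lemma map_matrix_of_real_mult:
  "map_matrix of_real (M ** N) = (map_matrix of_real M ** map_matrix of_real N :: complex ^ 'd ^ 'd)"
  by (simp add: vec_eq_iff matrix_matrix_mult_def)

locale expansive_matrix =
  fixes A :: "int ^ 'd ^ 'd"
  assumes expansive: "expansive A"
begin

definition dil :: "int \<Rightarrow> real ^ 'd \<Rightarrow> real ^ 'd" where
  "dil j x = mat_powi (transpose (real_mat A)) j *v x"

lemma det_nz: "det A \<noteq> 0"
  using expansive by (rule expansive_det_nz)

lemma invertible_real_mat: "invertible (real_mat A)" "invertible (transpose (real_mat A))"
  using det_nz by (simp_all add: invertible_det_nz det_map_matrix_of_int)

lemma dil_0 [simp]: "dil 0 x = x"
  by (simp add: dil_def)

lemma dil_dil: "dil i (dil j x) = dil (i + j) x"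
  by (simp add: dil_def mat_powi_add invertible_real_mat matrix_vector_mul_assoc)

lemma dil_inverse [simp]: "dil j (dil (- j) x) = x" "dil (- j) (dil j x) = x"
  by (simp_all add: dil_dil)

lemma linear_dil: "linear (dil j)"
  unfolding dil_def by (rule matrix_vector_mul_linear)

lemma dil_diff: "dil j (x - y) = dil j x - dil j y"
  and dil_zero [simp]: "dil j 0 = 0"
  using linear_dil by (simp_all add: linear_diff linear_0)

lemma continuous_dil: "continuous_on S (dil j)"
  by (rule linear_continuous_on) (simp add: linear_dil linear_conv_bounded_linear[symmetric])

lemma det_dil: "det (matrix (dil j)) = real_of_int (det A) powi j"
  by (simp add: dil_def[abs_def] matrix_of_matrix_vector_mul det_mat_powi invertible_real_mat
      det_map_matrix_of_int)

lemma inner_dil: "b \<bullet> dil j x = (mat_powi (real_mat A) j *v b) \<bullet> x"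
  unfolding dil_def mat_powi_transpose[OF invertible_real_mat(1)]
  by (metis dot_lmul_matrix inner_commute transpose_matrix_vector)

lemma torus_endo_dil: "torus_endo (e2pi x) A = e2pi (dil 1 x)"
  by (simp add: torus_endo_e2pi dil_def del: transpose_matrix_vector)

text \<open>The eigenvalues of \<open>A\<^sup>T\<close> are those of \<open>A\<close>, so those of its inverse have modulus less
  than one.\<close>

lemma dil_tendsto_0: "(\<lambda>n. dil (- int n) x) \<longlonglongrightarrow> 0"
proof -
  define B where "B = transpose (real_mat A)"
  define cv :: "real ^ 'd \<Rightarrow> complex ^ 'd" where "cv y = (\<chi> i. of_real (y $ i))" for y
  define C :: "complex ^ 'd ^ 'd" where "C = map_matrix of_real (matrix_inv B)"
  have BC: "map_matrix of_real B ** C = mat 1"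
    unfolding C_def B_def map_matrix_of_real_mult[symmetric] matrix_inv_right[OF invertible_real_mat(2)]
    by (simp add: vec_eq_iff mat_def)
  have eig: "norm l < 1" if v: "v \<noteq> 0" "C *v v = l *s v" for l v
  proof -
    have eq: "v = l *s (map_matrix of_real B *v v)"
      by (metis BC matrix_vector_mul_assoc matrix_vector_mul_lid v(2) vector_scalar_commute)
    have "l \<noteq> 0" using eq v(1) by auto
    then have "map_matrix of_real B *v v = (1 / l) *s v"
      by (subst (2) eq) (simp add: vector_smult_assoc)
    moreover have "map_matrix of_real B = (transpose (map_matrix of_int A) :: complex ^ 'd ^ 'd)"
      by (simp add: B_def vec_eq_iff transpose_def)
    ultimately have "norm (1 / l) > 1"
      using expansive_transpose_eigenvalue[OF expansive v(1)] by metis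
    then show ?thesis using \<open>l \<noteq> 0\<close> by (simp add: norm_divide field_simps)
  qed
  have step: "C *v cv y = cv (matrix_inv B *v y)" for y
    by (simp add: C_def cv_def vec_eq_iff matrix_vector_mult_def)
  have pow: "(((*v) C) ^^ n) (cv x) = cv (dil (- int n) x)" for n
  proof (induction n)
    case (Suc n)
    have "dil (- int (Suc n)) x = matrix_inv B *v dil (- int n) x"
      by (cases n) (simp_all add: dil_def mat_powi_def B_def nat_add_distrib matrix_vector_mul_assoc
          del: transpose_matrix_vector)
    with Suc step show ?case by simp
  qed simp
  have "(\<lambda>n. cv (dil (- int n) x)) \<longlonglongrightarrow> 0"
    using matrix_power_tendsto_0[where M = C and v = "cv x", OF eig] unfolding pow by simp
  then have "(\<lambda>n. norm (cv (dil (- int n) x))) \<longlonglongrightarrow> 0"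
    by (rule tendsto_norm_zero)
  moreover have "norm (cv y) = norm y" for y
    by (simp add: cv_def norm_vec_def)
  ultimately show ?thesis by (simp add: tendsto_norm_zero_iff)
qed

end


section \<open>The points of the solenoid converging to the identity\<close>

lemma small_real_vec_eq_0:
  assumes "norm (real_vec k) < 1"
  shows "real_vec k = 0"
proof -
  have "\<bar>real_of_int (k $ i)\<bar> < 1" for i
    using component_le_norm_cart[of "real_vec k" i] assms by (simp add: real_vec_def)
  then have "k $ i = 0" for i by (metis of_int_abs of_int_less_1_iff zabs_less_one_iff)
  then show ?thesis by (simp add: real_vec_def vec_eq_iff)
qed

text \<open>The principal argument is continuous at \<open>1\<close>.\<close>

lemma small_logarithms:
  fixes z :: "nat \<Rightarrow> complex ^ 'd"
  assumes z: "\<And>n. z n \<in> torus" "z \<longlonglongrightarrow> 1"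
  obtains x where "\<And>n. z n = e2pi (x n)" "x \<longlonglongrightarrow> 0"
proof
  define x :: "nat \<Rightarrow> real ^ 'd" where "x n = (\<chi> i. Arg (z n $ i) / (2 * pi))" for n
  have "cis (Arg (z n $ i)) = z n $ i" for n i
    using z(1)[of n] cis_Arg[of "z n $ i"]
    by (metis (mono_tags, lifting) div_by_1 mem_Collect_eq norm_zero of_real_1 sgn_eq torus_def zero_neq_one)
  then show "z n = e2pi (x n)" for n
    by (simp add: vec_eq_iff x_def)
  show "x \<longlonglongrightarrow> 0"
  proof (rule vec_tendstoI)
    fix i
    have "(\<lambda>n. z n $ i) \<longlonglongrightarrow> 1" using tendsto_vec_nth[OF z(2), of i] by simp
    then have "(\<lambda>n. Arg (z n $ i)) \<longlonglongrightarrow> Arg 1"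
      by (intro isCont_tendsto_compose[OF continuous_at_Arg]) auto
    then have "(\<lambda>n. Arg (z n $ i) / (2 * pi)) \<longlonglongrightarrow> Arg 1 / (2 * pi)"
      by (rule tendsto_divide[OF _ tendsto_const]) auto
    moreover have "Arg 1 = 0" using Arg_of_real[of 1] by simp
    ultimately show "(\<lambda>n. x n $ i) \<longlonglongrightarrow> 0 $ i" by (simp add: x_def)
  qed
qed

context expansive_matrix
begin

lemma ihat_dil: "ihat A x = (\<lambda>n. e2pi (dil (- int n) x))"
  by (simp add: ihat_def dil_def)

lemma ihat_0: "ihat A x 0 = e2pi x"
  by (simp add: ihat_dil)

lemma solenoid_shift_ihat: "solenoid_shift A (ihat A x) = ihat A (dil 1 x)"
proof
  fix n show "solenoid_shift A (ihat A x) n = ihat A (dil 1 x) n"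
    by (cases n) (simp_all add: solenoid_shift_def ihat_dil torus_endo_dil dil_dil)
qed

lemma ihat_in_solenoid1: "ihat A x \<in> solenoid1 A"
proof -
  have "(\<lambda>n. e2pi (dil (- int n) x)) \<longlonglongrightarrow> e2pi 0"
    using continuous_e2pi[of UNIV] dil_tendsto_0 by (auto simp: continuous_on_def intro: continuous_on_tendsto_compose[OF continuous_e2pi[of UNIV]])
  moreover have "e2pi (0 :: real ^ 'd) = 1" by (simp add: vec_eq_iff)
  ultimately show ?thesis
    by (simp add: solenoid1_def solenoid_def ihat_dil torus_endo_dil dil_dil)
qed

text \<open>If \<open>x\<close> and \<open>y\<close> have the same image, every \<open>(A\<^sup>T)\<^sup>-\<^sup>n (x - y)\<close> is an integer vector; these
  vectors tend to \<open>0\<close>, so one of them is \<open>0\<close>.\<close>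

lemma inj_ihat: "inj (ihat A)"
proof
  fix x y assume eq: "ihat A x = ihat A y"
  have "\<exists>k. dil (- int n) (x - y) = real_vec k" for n
  proof -
    have "e2pi (dil (- int n) x) = e2pi (dil (- int n) y)"
      using fun_cong[OF eq, of n] by (simp add: ihat_dil)
    then show ?thesis by (auto elim!: e2pi_eqD simp: dil_diff)
  qed
  moreover obtain n where "norm (dil (- int n) (x - y)) < 1"
    using LIMSEQ_D[OF dil_tendsto_0[of "x - y"], of 1] by auto
  ultimately have "dil (- int n) (x - y) = 0" by (metis small_real_vec_eq_0)
  then have "dil (int n) (dil (- int n) (x - y)) = 0" by simp
  then show "x = y" by simp
qed

text \<open>For small logarithms \<open>x\<^sub>n\<close> of \<open>z\<^sub>n\<close> the differences \<open>A\<^sup>T x\<^sub>n\<^sub>+\<^sub>1 - x\<^sub>n\<close> are integral and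
  tend to \<open>0\<close>, so they vanish from some index on; from there the logarithms are
  \<open>(A\<^sup>T)\<^sup>-\<^sup>n x\<close> for one fixed \<open>x\<close>.\<close>

lemma solenoid1_subset_range_ihat: "solenoid1 A \<subseteq> range (ihat A)"
proof
  fix z assume z: "z \<in> solenoid1 A"
  then have tor: "\<And>n. z n \<in> torus" and endo: "\<And>n. torus_endo (z (Suc n)) A = z n"
    and lim: "z \<longlonglongrightarrow> 1" by (auto simp: solenoid1_def solenoid_def)
  obtain x where x: "\<And>n. z n = e2pi (x n)" and x0: "x \<longlonglongrightarrow> 0"
    using small_logarithms[OF tor lim] by blast
  define d where "d n = dil 1 (x (Suc n)) - x n" for n
  have "(\<lambda>n. dil 1 (x (Suc n))) \<longlonglongrightarrow> dil 1 0"
    by (rule continuous_on_tendsto_compose[OF continuous_dil[of UNIV]])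
      (use x0 in \<open>auto intro: LIMSEQ_Suc\<close>)
  from tendsto_diff[OF this x0] have d0: "d \<longlonglongrightarrow> 0" by (simp add: d_def[abs_def])
  obtain N where N: "\<And>n. n \<ge> N \<Longrightarrow> norm (d n) < 1"
    using LIMSEQ_D[OF d0, of 1] by auto
  have d_int: "\<exists>k. d n = real_vec k" for n
  proof -
    have "e2pi (dil 1 (x (Suc n))) = e2pi (x n)"
      using endo[of n] by (simp add: x torus_endo_dil)
    then show ?thesis by (auto elim!: e2pi_eqD simp: d_def)
  qed
  have step: "dil 1 (x (Suc n)) = x n" if "n \<ge> N" for n
    using d_int[of n] N[OF that] small_real_vec_eq_0 by (fastforce simp: d_def)
  define y where "y = dil (int N) (x N)"
  have tail: "x (N + m) = dil (- int (N + m)) y" for m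
  proof (induction m)
    case 0 then show ?case by (simp add: y_def)
  next
    case (Suc m)
    have "x (Suc (N + m)) = dil (-1) (dil 1 (x (Suc (N + m))))" by simp
    also have "\<dots> = dil (-1) (x (N + m))" using step[of "N + m"] by simp
    also have "\<dots> = dil (- int (N + Suc m)) y" by (simp add: Suc dil_dil)
    finally show ?case by simp
  qed
  have head: "z (N - m) = ihat A y (N - m)" if "m \<le> N" for m
    using that
  proof (induction m)
    case 0
    then show ?case using tail[of 0] by (simp add: x ihat_dil)
  next
    case (Suc m)
    then have "Suc (N - Suc m) = N - m" by simp
    then have "z (N - Suc m) = torus_endo (z (N - m)) A" using endo[of "N - Suc m"] by simp
    also have "\<dots> = ihat A y (N - Suc m)"
      using Suc by (simp add: ihat_dil torus_endo_dil dil_dil algebra_simps of_nat_diff)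
    finally show ?case .
  qed
  have "z n = ihat A y n" for n
  proof (cases "n \<le> N")
    case True
    then show ?thesis using head[of "N - n"] by simp
  next
    case False
    then show ?thesis using tail[of "n - N"] by (simp add: x ihat_dil)
  qed
  then show "z \<in> range (ihat A)" by blast
qed

lemma range_ihat: "range (ihat A) = solenoid1 A"
  using ihat_in_solenoid1 solenoid1_subset_range_ihat by blast

end


section \<open>Linear changes of variables\<close>

lemma borel_measurable_linear:
  fixes f :: "'a::euclidean_space \<Rightarrow> 'b::euclidean_space"
  assumes "linear f"
  shows "f \<in> borel_measurable borel"
  using assms
  by (intro borel_measurable_continuous_onI linear_continuous_on) (simp add: linear_conv_bounded_linear)

lemma nn_integral_lborel_translate:
  fixes f :: "'a::euclidean_space \<Rightarrow> ennreal"
  assumes "f \<in> borel_measurable borel"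
  shows "(\<integral>\<^sup>+ x. f (a + x) \<partial>lborel) = (\<integral>\<^sup>+ x. f x \<partial>lborel)"
proof -
  have "(\<integral>\<^sup>+ x. f x \<partial>lborel) = (\<integral>\<^sup>+ x. f x \<partial>distr lborel borel ((+) a))"
    by (simp add: lborel_distr_plus)
  also have "\<dots> = (\<integral>\<^sup>+ x. f (a + x) \<partial>lborel)"
    using assms by (subst nn_integral_distr) auto
  finally show ?thesis by simp
qed

text \<open>Uniqueness of Haar measure for the translation invariant measure \<open>E \<mapsto> \<bar>f\<^sup>-\<^sup>1 E\<bar>\<close>: integrate
  \<open>1\<^sub>E (f x) 1\<^sub>Q (y - f x)\<close> in both orders, replacing \<open>x\<close> by \<open>x + f\<^sup>-\<^sup>1 y\<close> in between.\<close>

lemma emeasure_vimage_linear: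
  fixes f :: "real ^ 'd \<Rightarrow> real ^ 'd"
  assumes f: "linear f" "bij f" and E: "E \<in> sets borel"
  shows "emeasure lborel (f -` E) = emeasure lborel (f -` unit_cube) * emeasure lborel E"
proof -
  have [measurable]: "f \<in> borel_measurable borel" by (rule borel_measurable_linear[OF f(1)])
  have scale: "emeasure lborel (f -` E) = c * emeasure lborel E"
    if c: "c = emeasure lborel ((\<lambda>x. - f x) -` unit_cube)" and E [measurable]: "E \<in> sets borel" for c E
  proof -
    define Q :: "(real ^ 'd) set" where "Q = unit_cube"
    have [measurable]: "Q \<in> sets borel" by (simp add: Q_def)
    have preE: "f -` E \<in> sets borel" by (rule measurable_sets_borel[OF _ E]) measurable
    have preQ: "(\<lambda>x. - f x) -` Q \<in> sets borel" by (rule measurable_sets_borel[of _ borel]) measurable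
    have Q1: "(\<integral>\<^sup>+ y. indicator Q (y - a) \<partial>lborel) = 1" for a :: "real ^ 'd"
      using nn_integral_lborel_translate[of "indicator Q" "- a"]
      by (simp add: Q_def emeasure_unit_cube)
    have "(\<lambda>x. indicator E (f x) :: ennreal) = indicator (f -` E)"
      by (auto simp: indicator_def fun_eq_iff)
    then have "emeasure lborel (f -` E) = (\<integral>\<^sup>+ x. indicator E (f x) \<partial>lborel)"
      using preE by simp
    also have "\<dots> = (\<integral>\<^sup>+ x. (\<integral>\<^sup>+ y. indicator E (f x) * indicator Q (y - f x) \<partial>lborel) \<partial>lborel)"
      by (subst nn_integral_cmult) (simp_all add: Q1)
    also have "\<dots> = (\<integral>\<^sup>+ y. (\<integral>\<^sup>+ x. indicator E (f x) * indicator Q (y - f x) \<partial>lborel) \<partial>lborel)"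
      by (rule lborel_pair.Fubini'[symmetric]) measurable
    also have "\<dots> = (\<integral>\<^sup>+ y. (\<integral>\<^sup>+ x. indicator E (y + f x) * indicator Q (- f x) \<partial>lborel) \<partial>lborel)"
    proof (rule nn_integral_cong)
      fix y
      have fy: "f (inv_into UNIV f y + x) = y + f x" for x
        using f by (simp add: linear_add bij_is_surj f_inv_into_f)
      have "(\<integral>\<^sup>+ x. indicator E (f x) * indicator Q (y - f x) \<partial>lborel)
          = (\<integral>\<^sup>+ x. indicator E (f (inv_into UNIV f y + x)) * indicator Q (y - f (inv_into UNIV f y + x)) \<partial>lborel)"
        by (rule nn_integral_lborel_translate[symmetric]) measurable
      then show "(\<integral>\<^sup>+ x. indicator E (f x) * indicator Q (y - f x) \<partial>lborel)
          = (\<integral>\<^sup>+ x. indicator E (y + f x) * indicator Q (- f x) \<partial>lborel)"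
        by (simp add: fy)
    qed
    also have "\<dots> = (\<integral>\<^sup>+ x. (\<integral>\<^sup>+ y. indicator E (f x + y) * indicator Q (- f x) \<partial>lborel) \<partial>lborel)"
      by (subst lborel_pair.Fubini') (simp_all add: add.commute)
    also have "\<dots> = (\<integral>\<^sup>+ x. emeasure lborel E * indicator Q (- f x) \<partial>lborel)"
      by (intro nn_integral_cong, subst nn_integral_multc)
        (simp_all add: nn_integral_lborel_translate[of "indicator E"])
    also have "\<dots> = (\<integral>\<^sup>+ x. emeasure lborel E * indicator ((\<lambda>x. - f x) -` Q) x \<partial>lborel)"
      by (rule nn_integral_cong) (simp add: indicator_def)
    also have "\<dots> = emeasure lborel E * (\<integral>\<^sup>+ x. indicator ((\<lambda>x. - f x) -` Q) x \<partial>lborel)"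
      using preQ by (subst nn_integral_cmult) simp_all
    also have "\<dots> = c * emeasure lborel E"
      using preQ by (simp add: c Q_def mult.commute)
    finally show ?thesis .
  qed
  \<comment> \<open>Applied to the cube itself, this identifies the constant.\<close>
  then show ?thesis
    using scale[OF refl borel_unit_cube] E by (simp add: emeasure_unit_cube)
qed

text \<open>The quantity that has to be shown equal to \<open>1\<close>.  It is multiplicative in \<open>f\<close>, hence
  determined by its values on generators.\<close>

definition linear_volume_factor :: "(real ^ 'd \<Rightarrow> real ^ 'd) \<Rightarrow> ennreal" where
  "linear_volume_factor f = emeasure lborel (f -` unit_cube) * ennreal \<bar>det (matrix f)\<bar>"

lemma linear_volume_factor_compose:
  assumes f: "linear f" "bij f" and g: "linear g" "bij g"
  shows "linear_volume_factor (f \<circ> g) = linear_volume_factor f * linear_volume_factor g"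
proof -
  have "f -` unit_cube \<in> sets borel"
    by (rule measurable_sets_borel[OF borel_measurable_linear[OF f(1)] borel_unit_cube])
  from emeasure_vimage_linear[OF g this] f(1) g(1) show ?thesis
    by (simp add: linear_volume_factor_def vimage_comp[symmetric] matrix_compose det_mul
        abs_mult ennreal_mult mult_ac)
qed

lemma linear_volume_factor_id: "linear_volume_factor (\<lambda>x. x) = 1"
  by (simp add: linear_volume_factor_def emeasure_unit_cube matrix_id_mat_1[unfolded id_def])

lemma linear_volume_factor_diagonal:
  assumes c: "\<And>i. c i \<noteq> 0"
  shows "linear_volume_factor (\<lambda>x :: real ^ 'd. \<chi> i. c i * x $ i) = 1"
proof -
  define T where "T = (\<lambda>x :: real ^ 'd. 0 + (\<Sum>j\<in>Basis. ((vec_lambda c \<bullet> j) * (x \<bullet> j)) *\<^sub>R j))"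
  have Basis: "(Basis :: (real ^ 'd) set) = range (\<lambda>i. axis i 1)"
    by (auto simp: Basis_vec_def)
  have inj: "inj (\<lambda>i. axis i (1::real) :: real ^ 'd)"
    by (auto simp: inj_def axis_eq_axis)
  have T: "T = (\<lambda>x. \<chi> i. c i * x $ i)"
  proof
    fix x show "T x = (\<chi> i. c i * x $ i)"
    proof (rule euclidean_eqI)
      fix b :: "real ^ 'd" assume b: "b \<in> Basis"
      then have "T x \<bullet> b = (vec_lambda c \<bullet> b) * (x \<bullet> b)"
        by (simp add: T_def inner_sum_left_Basis)
      with b show "T x \<bullet> b = (\<chi> i. c i * x $ i) \<bullet> b" by (auto simp: Basis inner_axis)
    qed
  qed
  have meas: "T \<in> borel_measurable borel" by (simp add: T_def)
  have nz: "vec_lambda c \<bullet> j \<noteq> 0" if "j \<in> Basis" for j :: "real ^ 'd"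
    using that c by (auto simp: Basis inner_axis)
  have "(\<Prod>j\<in>Basis. \<bar>vec_lambda c \<bullet> (j :: real ^ 'd)\<bar>) = (\<Prod>i\<in>UNIV. \<bar>c i\<bar>)"
    unfolding Basis prod.reindex[OF inj] by (simp add: inner_axis)
  then have prd: "(\<Prod>j\<in>Basis. ennreal \<bar>vec_lambda c \<bullet> (j :: real ^ 'd)\<bar>) = ennreal (\<Prod>i\<in>UNIV. \<bar>c i\<bar>)"
    by (simp add: prod_ennreal)
  have "1 = emeasure (density (distr lborel borel T) (\<lambda>_. (\<Prod>j\<in>Basis. \<bar>vec_lambda c \<bullet> (j :: real ^ 'd)\<bar>))) unit_cube"
    using lborel_affine_euclidean[of "\<lambda>j. vec_lambda c \<bullet> j" 0] nz emeasure_unit_cube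
    by (simp add: T_def)
  also have "\<dots> = (\<integral>\<^sup>+ x. indicator unit_cube x * (\<Prod>i\<in>UNIV. ennreal \<bar>c i\<bar>) \<partial>distr lborel borel T)"
    using meas prd by (simp add: emeasure_density prod_ennreal mult.commute)
  also have "\<dots> = (\<integral>\<^sup>+ x. indicator unit_cube x \<partial>distr lborel borel T) * (\<Prod>i\<in>UNIV. ennreal \<bar>c i\<bar>)"
    by (rule nn_integral_multc) simp
  also have "\<dots> = emeasure lborel (T -` unit_cube) * (\<Prod>i\<in>UNIV. ennreal \<bar>c i\<bar>)"
    using meas by (simp add: emeasure_distr)
  also have "(\<Prod>i\<in>UNIV. ennreal \<bar>c i\<bar>) = ennreal \<bar>det (matrix T)\<bar>"
    by (simp add: T matrix_def axis_def det_diagonal prod_ennreal abs_prod)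
  finally show ?thesis by (simp add: linear_volume_factor_def T)
qed

text \<open>On the generators of the general linear group the factor is determined by relations: a
  transposition is an involution, and the square of a shear is conjugate to it by a diagonal
  matrix.\<close>

lemma linear_volume_factor_1:
  fixes f :: "real ^ 'd \<Rightarrow> real ^ 'd"
  assumes "linear f" "bij f"
  shows "linear_volume_factor f = 1"
proof -
  have "bij f \<longrightarrow> linear_volume_factor f = 1"
  proof (rule induct_linear_elementary[where P = "\<lambda>f. bij f \<longrightarrow> linear_volume_factor f = 1", OF \<open>linear f\<close>])
    fix f g :: "real ^ 'd \<Rightarrow> real ^ 'd"
    assume lin: "linear f" "linear g"
      and IH: "bij f \<longrightarrow> linear_volume_factor f = 1" "bij g \<longrightarrow> linear_volume_factor g = 1"
    show "bij (f \<circ> g) \<longrightarrow> linear_volume_factor (f \<circ> g) = 1"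
    proof
      assume "bij (f \<circ> g)"
      then have "surj (f \<circ> g)" "inj (f \<circ> g)" using bij_is_surj bij_is_inj by blast+
      then have "surj f" unfolding surj_def comp_apply by blast
      have "inj g" using \<open>inj (f \<circ> g)\<close> by (rule inj_on_imageI2)
      with \<open>surj f\<close> have "bij f" "bij g"
        using lin by (simp_all add: bij_def linear_injective_imp_surjective linear_surjective_imp_injective)
      then show "linear_volume_factor (f \<circ> g) = 1"
        using lin IH by (simp add: linear_volume_factor_compose)
    qed
  next
    fix f :: "real ^ 'd \<Rightarrow> real ^ 'd" and i
    assume "\<And>x. f x $ i = 0"
    then have "f x \<noteq> axis i 1" for x by (metis axis_nth zero_neq_one)
    moreover have "\<exists>x. f x = axis i 1" if "bij f"
      using surjD[OF bij_is_surj[OF that], of "axis i 1"] by metis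
    ultimately show "bij f \<longrightarrow> linear_volume_factor f = 1" by blast
  next
    fix c :: "'d \<Rightarrow> real"
    show "bij (\<lambda>x :: real ^ 'd. \<chi> i. c i * x $ i)
        \<longrightarrow> linear_volume_factor (\<lambda>x :: real ^ 'd. \<chi> i. c i * x $ i) = 1"
    proof
      assume bij: "bij (\<lambda>x :: real ^ 'd. \<chi> i. c i * x $ i)"
      have "c i \<noteq> 0" for i
      proof
        assume "c i = 0"
        obtain x where "axis i (1 :: real) = (\<chi> i. c i * x $ i)"
          using surjD[OF bij_is_surj[OF bij], of "axis i 1"] by blast
        from arg_cong[OF this, of "\<lambda>v. v $ i"] \<open>c i = 0\<close> show False by simp
      qed
      then show "linear_volume_factor (\<lambda>x :: real ^ 'd. \<chi> i. c i * x $ i) = 1"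
        by (rule linear_volume_factor_diagonal)
    qed
  next
    fix m n :: 'd
    let ?h = "\<lambda>x :: real ^ 'd. \<chi> i. x $ Transposition.transpose m n i"
    have lin: "linear ?h" by (rule linearI) (simp_all add: vec_eq_iff)
    have inv: "?h \<circ> ?h = (\<lambda>x. x)" by (simp add: fun_eq_iff vec_eq_iff)
    then have "bij ?h" by (intro o_bij[of ?h ?h]) (simp_all add: id_def)
    then have "linear_volume_factor ?h * linear_volume_factor ?h = 1"
      using linear_volume_factor_compose[OF lin _ lin] inv by (simp add: linear_volume_factor_id)
    then show "bij ?h \<longrightarrow> linear_volume_factor ?h = 1"
      by (cases "linear_volume_factor ?h")
        (auto simp: ennreal_mult_top abs_if square_eq_1_iff simp flip: ennreal_mult ennreal_1)
  next
    fix m n :: 'd assume mn: "m \<noteq> n"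
    define D where "D = (\<lambda>t (x :: real ^ 'd). \<chi> i. (if i = m then t else 1) * x $ i)"
    define S where "S = (\<lambda>t (x :: real ^ 'd). \<chi> i. if i = m then x $ m + t * x $ n else x $ i)"
    have lin: "linear (S t)" "linear (D t)" for t
      by (rule linearI; simp add: S_def D_def vec_eq_iff algebra_simps)+
    have SS: "S s \<circ> S t = S (s + t)" for s t
      using mn by (simp add: S_def fun_eq_iff vec_eq_iff algebra_simps)
    have S0: "S 0 = (\<lambda>x. x)" by (simp add: S_def fun_eq_iff vec_eq_iff)
    have bijS: "bij (S t)" for t
      by (rule o_bij[of "S (- t)"]) (simp_all add: SS S0 id_def)
    have bijD: "bij (D t)" if "t \<noteq> 0" for t
      by (rule o_bij[of "D (1 / t)"]) (use that in \<open>auto simp: D_def fun_eq_iff vec_eq_iff\<close>)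
    have D1: "linear_volume_factor (D t) = 1" if "t \<noteq> 0" for t
      unfolding D_def by (rule linear_volume_factor_diagonal) (use that in auto)
    have conj: "D 2 \<circ> S 1 \<circ> D (1 / 2) = S 2"
      using mn by (simp add: S_def D_def fun_eq_iff vec_eq_iff)
    let ?v = "\<lambda>t. linear_volume_factor (S t)"
    have "?v 2 = linear_volume_factor (D 2 \<circ> S 1) * linear_volume_factor (D (1 / 2))"
      unfolding conj[symmetric]
      by (intro linear_volume_factor_compose linear_compose lin bij_comp bijS bijD) auto
    also have "\<dots> = ?v 1"
      using linear_volume_factor_compose[OF lin(2) _ lin(1) bijS, of 2 1] by (simp add: D1 bijD)
    finally have "?v 1 * ?v 1 = ?v 1"
      using linear_volume_factor_compose[OF lin(1) bijS lin(1) bijS, of 1 1] by (simp add: SS)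
    moreover have "?v 1 * ?v (-1) = 1"
      using linear_volume_factor_compose[OF lin(1) bijS lin(1) bijS, of 1 "-1"]
      by (simp add: SS S0 linear_volume_factor_id)
    ultimately have "?v 1 = 1" by (metis mult.assoc mult.right_neutral)
    moreover have "S 1 = (\<lambda>x. \<chi> i. if i = m then x $ m + x $ n else x $ i)"
      by (simp add: S_def fun_eq_iff)
    ultimately show "bij (\<lambda>x :: real ^ 'd. \<chi> i. if i = m then x $ m + x $ n else x $ i)
        \<longrightarrow> linear_volume_factor (\<lambda>x :: real ^ 'd. \<chi> i. if i = m then x $ m + x $ n else x $ i) = 1"
      by simp
  qed
  with \<open>bij f\<close> show ?thesis by blast
qed

lemma emeasure_lborel_vimage_linear:
  fixes f :: "real ^ 'd \<Rightarrow> real ^ 'd"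
  assumes f: "linear f" and det: "det (matrix f) \<noteq> 0" and E: "E \<in> sets borel"
  shows "emeasure lborel (f -` E) = ennreal (1 / \<bar>det (matrix f)\<bar>) * emeasure lborel E"
proof -
  have "bij f"
    using f det det_nz_iff_inj[OF f] linear_injective_imp_surjective[OF f] by (auto simp: bij_def)
  have "ennreal (1 / \<bar>det (matrix f)\<bar>) * ennreal \<bar>det (matrix f)\<bar> = 1"
    using det by (simp flip: ennreal_mult)
  then have "emeasure lborel (f -` unit_cube) = ennreal (1 / \<bar>det (matrix f)\<bar>)"
    using linear_volume_factor_1[OF f \<open>bij f\<close>]
    by (metis linear_volume_factor_def mult.assoc mult.commute mult_1)
  then show ?thesis using emeasure_vimage_linear[OF f \<open>bij f\<close> E] by simp
qed


section \<open>Measurable inverses\<close>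

text \<open>A continuous injection maps the closed subsets of a \<open>\<sigma>\<close>-compact set to countable unions of
  compact sets, hence to Borel sets.\<close>

lemma inv_into_borel_measurable_sigma_compact:
  fixes f :: "'a::topological_space \<Rightarrow> 'b::t2_space" and K :: "nat \<Rightarrow> 'a set"
  assumes K: "\<And>n. compact (K n)" "\<Omega> = (\<Union>n. K n)" and f: "continuous_on \<Omega> f" "inj_on f \<Omega>"
  shows "inv_into \<Omega> f \<in> borel_measurable (restrict_space borel (f ` \<Omega>))"
proof (rule borel_measurableI)
  fix S :: "'a set" assume S: "open S"
  have "closed (f ` (K n - S))" for n
    by (intro compact_imp_closed compact_continuous_image continuous_on_subset[OF f(1)])
      (use K S compact_diff in auto)
  then have "- (\<Union>n. f ` (K n - S)) \<in> sets borel"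
    by (intro borel_comp sets.countable_UN) (auto simp: borel_closed)
  moreover have "inv_into \<Omega> f -` S \<inter> space (restrict_space borel (f ` \<Omega>))
      = f ` \<Omega> \<inter> - (\<Union>n. f ` (K n - S))"
  proof -
    have "inv_into \<Omega> f (f x) \<in> S \<longleftrightarrow> f x \<in> - (\<Union>n. f ` (K n - S))" if "x \<in> \<Omega>" for x
    proof -
      have "x \<in> S \<longleftrightarrow> f x \<notin> (\<Union>n. f ` (K n - S))"
      proof
        assume "x \<in> S"
        show "f x \<notin> (\<Union>n. f ` (K n - S))"
        proof
          assume "f x \<in> (\<Union>n. f ` (K n - S))"
          then obtain n y where y: "y \<in> K n" "y \<notin> S" "f x = f y" by blast
          then have "x = y" using f(2) that K(2) by (intro inj_onD[OF f(2)]) auto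
          with \<open>x \<in> S\<close> y show False by simp
        qed
      qed (use that K(2) in blast)
      with that f(2) show ?thesis by (simp only: inv_into_f_f Compl_iff)
    qed
    note iff = this
    have "(z \<in> inv_into \<Omega> f -` S \<and> z \<in> f ` \<Omega>)
        \<longleftrightarrow> z \<in> f ` \<Omega> \<and> z \<in> - (\<Union>n. f ` (K n - S))" for z
      by (metis (no_types, lifting) iff imageE vimage_eq)
    then show ?thesis
      by (simp only: space_restrict_space space_borel Int_UNIV_right set_eq_iff Int_iff simp_thms)
  qed
  ultimately show "inv_into \<Omega> f -` S \<inter> space (restrict_space borel (f ` \<Omega>))
      \<in> sets (restrict_space borel (f ` \<Omega>))"
    by (auto simp: sets_restrict_space)
qed


section \<open>The image of Lebesgue measure and sums over fibres\<close>

text \<open>Both sides are the supremum of the sums over the members of an exhausting sequence of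
  finite sets.\<close>

lemma infsum_ennreal_countable:
  fixes f :: "'a::countable \<Rightarrow> ennreal"
  shows "infsum f UNIV = (\<integral>\<^sup>+ k. f k \<partial>count_space UNIV)"
proof (rule antisym)
  have fin: "sum f F = (\<integral>\<^sup>+ k. f k * indicator F k \<partial>count_space UNIV)" if "finite F" for F
    using that by (subst nn_integral_count_space'[of F]) (auto simp: indicator_def intro!: sum.cong)
  have eq: "infsum f UNIV = (SUP F\<in>{F. finite F \<and> F \<subseteq> UNIV}. sum f F)"
    by (rule nonneg_infsum_complete) simp
  show "infsum f UNIV \<le> (\<integral>\<^sup>+ k. f k \<partial>count_space UNIV)"
    unfolding eq by (rule SUP_least) (auto simp: fin indicator_def intro!: nn_integral_mono)
  define F where "F n = {k :: 'a. to_nat k < n}" for n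
  have F: "finite (F n)" for n
    unfolding F_def by (rule finite_subset[OF _ finite_vimageI[OF finite_lessThan[of n] inj_to_nat]]) auto
  have "f k = (SUP n. f k * indicator (F n) k)" for k
  proof (rule antisym)
    show "f k \<le> (SUP n. f k * indicator (F n) k)"
      by (rule SUP_upper2[of "Suc (to_nat k)"]) (auto simp: F_def)
  qed (auto intro!: SUP_least simp: indicator_def)
  then have "(\<integral>\<^sup>+ k. f k \<partial>count_space UNIV) = (\<integral>\<^sup>+ k. (SUP n. f k * indicator (F n) k) \<partial>count_space UNIV)"
    by simp
  also have "\<dots> = (SUP n. \<integral>\<^sup>+ k. f k * indicator (F n) k \<partial>count_space UNIV)"
    by (rule nn_integral_monotone_convergence_SUP)
      (auto simp: incseq_def le_fun_def F_def indicator_def)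
  also have "\<dots> = (SUP n. sum f (F n))" by (simp add: fin F)
  also have "\<dots> \<le> infsum f UNIV"
    unfolding eq by (rule SUP_least) (auto intro!: SUP_upper F)
  finally show "(\<integral>\<^sup>+ k. f k \<partial>count_space UNIV) \<le> infsum f UNIV" .
qed

lemma inj_real_vec: "inj real_vec"
  by (auto simp: inj_def real_vec_def vec_eq_iff)

lemma inj_on_e2pi_unit_cube: "inj_on e2pi unit_cube"
proof
  fix x y :: "real ^ 'd" assume xy: "x \<in> unit_cube" "y \<in> unit_cube" "e2pi x = e2pi y"
  then obtain k where k: "x = y + real_vec k" by (metis e2pi_eqD)
  have "x - real_vec k \<in> unit_cube" "x - real_vec 0 \<in> unit_cube"
    using xy k by (simp_all add: real_vec_def zero_vec_def[symmetric])
  then have "k = 0" using unit_cube_translates by blast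
  then show "x = y" using k by (simp add: real_vec_def zero_vec_def[symmetric])
qed

lemma e2pi_unit_cube: "e2pi ` unit_cube = (torus :: (complex ^ 'd) set)"
proof
  show "torus \<subseteq> e2pi ` (unit_cube :: (real ^ 'd) set)"
  proof
    fix z :: "complex ^ 'd" assume "z \<in> torus"
    then obtain x where x: "z = e2pi x" by (rule torus_e2piE)
    obtain k where k: "x - real_vec k \<in> unit_cube" using unit_cube_translates by blast
    have "e2pi (x - real_vec k + real_vec k) = e2pi (x - real_vec k)"
      by (subst e2pi_add) simp
    with x k show "z \<in> e2pi ` unit_cube" by auto
  qed
qed auto

text \<open>The half-open cube is the union of the compact cubes \<open>[0, 1 - 1/n]\<^sup>d\<close>.  The inverse is a Borel
  choice of logarithms on the torus, through which sums over the fibres become measurable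
  functions of the base point.\<close>

lemma measurable_inv_e2pi:
  "inv_into unit_cube e2pi \<in> borel_measurable (restrict_space borel (torus :: (complex ^ 'd) set))"
proof -
  define K :: "nat \<Rightarrow> (real ^ 'd) set" where "K n = cbox 0 (\<chi> i. 1 - 1 / real (Suc n))" for n
  have "unit_cube = (\<Union>n. K n)"
  proof (intro equalityI subsetI)
    fix x :: "real ^ 'd" assume x: "x \<in> unit_cube"
    have "\<exists>n. x $ i \<le> 1 - 1 / real (Suc n)" for i
    proof -
      obtain n where "inverse (real (Suc n)) < 1 - x $ i"
        using reals_Archimedean[of "1 - x $ i"] x by (auto simp: unit_cube_def)
      then show ?thesis by (intro exI[of _ n]) (simp add: inverse_eq_divide)
    qed
    then obtain n where n: "\<And>i. x $ i \<le> 1 - 1 / real (Suc (n i))" by metis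
    define m where "m = Max (range n)"
    have "x $ i \<le> 1 - 1 / real (Suc m)" for i
    proof -
      have "n i \<le> m" by (simp add: m_def)
      then have "1 / real (Suc m) \<le> 1 / real (Suc (n i))" by (intro divide_left_mono) auto
      then show ?thesis using n[of i] by linarith
    qed
    then show "x \<in> (\<Union>n. K n)" using x by (auto simp: K_def unit_cube_def mem_box_cart)
  next
    fix x :: "real ^ 'd" assume "x \<in> (\<Union>n. K n)"
    then obtain n where n: "\<And>i. 0 \<le> x $ i \<and> x $ i \<le> 1 - 1 / real (Suc n)"
      by (auto simp: K_def mem_box_cart)
    have "x $ i < 1" for i
    proof -
      have "0 < 1 / real (Suc n)" by simp
      then show ?thesis using n[of i] by linarith
    qed
    with n show "x \<in> unit_cube" by (auto simp: unit_cube_def)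
  qed
  moreover have "compact (K n)" for n by (simp add: K_def compact_cbox)
  ultimately show ?thesis
    using inv_into_borel_measurable_sigma_compact[of K unit_cube e2pi]
    by (simp add: continuous_e2pi inj_on_e2pi_unit_cube e2pi_unit_cube)
qed

lemma emeasure_lborel_cube_translates:
  fixes S :: "(real ^ 'd) set"
  assumes [measurable]: "S \<in> sets borel"
  shows "(\<integral>\<^sup>+ k. (\<integral>\<^sup>+ x. indicator S (x + real_vec k) * indicator unit_cube x \<partial>lborel) \<partial>count_space UNIV)
    = emeasure lborel S"
proof -
  have tr: "(\<lambda>x. - real_vec k + x) -` unit_cube \<in> sets borel" for k :: "int ^ 'd"
    by (rule measurable_sets_borel[OF _ borel_unit_cube]) measurable
  have "(\<integral>\<^sup>+ x. indicator S (x + real_vec k) * indicator unit_cube x \<partial>lborel)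
      = emeasure lborel (S \<inter> (\<lambda>x. - real_vec k + x) -` unit_cube)" for k :: "int ^ 'd"
  proof -
    let ?D = "S \<inter> (\<lambda>x. - real_vec k + x) -` unit_cube"
    have D: "?D \<in> sets borel" using tr by simp
    have D': "(\<lambda>x. real_vec k + x) -` ?D \<in> sets borel"
      by (rule measurable_sets_borel[OF _ D]) measurable
    have "(\<integral>\<^sup>+ x. indicator S (x + real_vec k) * indicator unit_cube x \<partial>lborel)
        = (\<integral>\<^sup>+ x. indicator ((\<lambda>x. real_vec k + x) -` ?D) x \<partial>lborel)"
      by (rule nn_integral_cong) (simp add: indicator_def add.commute)
    also have "\<dots> = emeasure lborel ((\<lambda>x. real_vec k + x) -` ?D)" using D' by simp
    finally show ?thesis unfolding emeasure_lborel_translate[OF D] .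
  qed
  then have "(\<integral>\<^sup>+ k. (\<integral>\<^sup>+ x. indicator S (x + real_vec k) * indicator unit_cube x \<partial>lborel) \<partial>count_space UNIV)
      = (\<integral>\<^sup>+ k. emeasure lborel (S \<inter> (\<lambda>x. - real_vec k + x) -` unit_cube) \<partial>count_space UNIV)"
    by simp
  also have "\<dots> = emeasure lborel (\<Union>k. S \<inter> (\<lambda>x. - real_vec k + x) -` unit_cube)"
  proof (rule emeasure_UN_countable[symmetric])
    show "disjoint_family_on (\<lambda>k. S \<inter> (\<lambda>x. - real_vec k + x) -` unit_cube) UNIV"
      using unit_cube_translates by (fastforce simp: disjoint_family_on_def)
  qed (use tr in auto)
  also have "(\<Union>k. S \<inter> (\<lambda>x. - real_vec k + x) -` unit_cube) = S"
    using unit_cube_translates by fastforce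
  finally show ?thesis .
qed

context expansive_matrix
begin

lemma bij_betw_fibre:
  "bij_betw (\<lambda>k. ihat A (x + real_vec k)) UNIV {w \<in> solenoid1 A. w 0 = e2pi x}"
  unfolding bij_betw_def
proof
  show "inj (\<lambda>k. ihat A (x + real_vec k))"
    by (rule injI) (metis add_left_imp_eq inj_ihat inj_real_vec injD)
  show "range (\<lambda>k. ihat A (x + real_vec k)) = {w \<in> solenoid1 A. w 0 = e2pi x}"
  proof (intro equalityI subsetI)
    fix w assume "w \<in> {w \<in> solenoid1 A. w 0 = e2pi x}"
    then obtain y where y: "w = ihat A y" "e2pi y = e2pi x"
      by (auto simp: range_ihat[symmetric] ihat_0)
    then obtain k where "y = x + real_vec k" by (metis e2pi_eqD)
    with y show "w \<in> range (\<lambda>k. ihat A (x + real_vec k))" by auto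
  qed (auto simp: ihat_in_solenoid1 ihat_0 e2pi_add)
qed

lemma fibre_sum:
  "(\<Sum>\<^sub>\<infinity>w\<in>{w \<in> solenoid1 A. w 0 = e2pi x}. indicator E w :: ennreal)
    = (\<integral>\<^sup>+ k. indicator E (ihat A (x + real_vec k)) \<partial>count_space UNIV)"
  using infsum_reindex_bij_betw[OF bij_betw_fibre[of x], of "indicator E :: _ \<Rightarrow> ennreal"]
  by (simp add: infsum_ennreal_countable)

lemma continuous_ihat: "continuous_on S (ihat A)"
  unfolding ihat_dil
  by (intro continuous_on_coordinatewise_then_product continuous_on_compose2[OF continuous_e2pi[of UNIV]]
      continuous_dil) auto

lemma measurable_ihat: "ihat A \<in> measurable lborel (restrict_space borel (solenoid1 A))"
  using borel_measurable_continuous_onI[OF continuous_ihat]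
  by (intro measurable_restrict_space2) (auto simp: ihat_in_solenoid1)

text \<open>\<open>\<real>\<^sup>d\<close> is the union of its closed balls about \<open>0\<close>, which are compact.\<close>

lemma measurable_inv_ihat: "inv_into UNIV (ihat A) \<in> borel_measurable (restrict_space borel (solenoid1 A))"
proof -
  have "(UNIV :: (real ^ 'd) set) = (\<Union>n. cball 0 (real n))"
    using real_arch_simple by (fastforce simp: dist_norm)
  from inv_into_borel_measurable_sigma_compact[OF _ this continuous_ihat inj_ihat]
  show ?thesis by (simp add: range_ihat compact_cball)
qed

text \<open>Over the fundamental domain \<open>[0,1)\<^sup>d\<close> of \<open>\<int>\<^sup>d\<close>, the fibre of \<open>e\<^sup>2\<^sup>\<pi>\<^sup>i\<^sup>x\<close> consists of the images of
  the translates \<open>x + k\<close>; the integral of the sums over the fibres is therefore Lebesgue measure,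
  cut into the translates of the cube.\<close>

lemma nn_integral_fibre_sum:
  assumes E: "E \<in> sets (restrict_space borel (solenoid1 A))"
  shows "(\<integral>\<^sup>+ z. (\<Sum>\<^sub>\<infinity>w\<in>{w \<in> solenoid1 A. w 0 = z}. indicator E w) \<partial>torus_haar)
    = emeasure lborel (ihat A -` E)"
proof -
  define S where "S = ihat A -` E"
  have S [measurable]: "S \<in> sets borel"
    using measurable_sets[OF measurable_ihat E] by (simp add: S_def)
  define G where "G x = (\<integral>\<^sup>+ k. indicator S (x + real_vec k) \<partial>count_space UNIV)" for x :: "real ^ 'd"
  have G [measurable]: "G \<in> borel_measurable borel"
    unfolding G_def
  proof (rule sigma_finite_measure.borel_measurable_nn_integral)
    show "(\<lambda>(x, k). indicator S (x + real_vec k) :: ennreal) \<in> borel_measurable (borel \<Otimes>\<^sub>M count_space UNIV)"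
      using measurable_compose[OF measurable_pair_swap'
          measurable_pair_measure_countable1[of UNIV "\<lambda>(k, x). indicator S (x + real_vec k) :: ennreal"]]
      by (simp add: case_prod_beta)
  qed (rule sigma_finite_measure_count_space)
  let ?s = "inv_into unit_cube (e2pi :: real ^ 'd \<Rightarrow> _)"
  have e2pi: "e2pi \<in> measurable (restrict_space lborel unit_cube) (restrict_space borel (torus :: (complex ^ 'd) set))"
    by (intro measurable_restrict_space2 measurable_restrict_space1) auto
  have "(\<integral>\<^sup>+ z. (\<Sum>\<^sub>\<infinity>w\<in>{w \<in> solenoid1 A. w 0 = z}. indicator E w) \<partial>torus_haar)
      = (\<integral>\<^sup>+ z. G (?s z) \<partial>torus_haar)"
  proof (rule nn_integral_cong)
    fix z :: "complex ^ 'd" assume "z \<in> space torus_haar"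
    then have "z \<in> e2pi ` unit_cube"
      by (simp add: torus_haar_eq cube_torus_def space_restrict_space e2pi_unit_cube)
    then have "e2pi (?s z) = z" by (rule f_inv_into_f)
    then show "(\<Sum>\<^sub>\<infinity>w\<in>{w \<in> solenoid1 A. w 0 = z}. indicator E w) = G (?s z)"
      using fibre_sum[where x = "?s z" and E = E] by (simp add: G_def S_def indicator_def)
  qed
  also have "\<dots> = (\<integral>\<^sup>+ x. G (?s (e2pi x)) \<partial>restrict_space lborel unit_cube)"
    unfolding torus_haar_eq cube_torus_def
    by (rule nn_integral_distr[OF e2pi]) (use measurable_compose[OF measurable_inv_e2pi G] in simp)
  also have "\<dots> = (\<integral>\<^sup>+ x. G x \<partial>restrict_space lborel unit_cube)"
    by (rule nn_integral_cong) (simp add: space_restrict_space inj_on_e2pi_unit_cube)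
  also have "\<dots> = (\<integral>\<^sup>+ x. G x * indicator unit_cube x \<partial>lborel)"
    by (rule nn_integral_restrict_space) simp
  also have "\<dots> = (\<integral>\<^sup>+ x. (\<integral>\<^sup>+ k. indicator S (x + real_vec k) * indicator unit_cube x \<partial>count_space UNIV) \<partial>lborel)"
    by (simp add: G_def nn_integral_multc)
  also have "\<dots> = (\<integral>\<^sup>+ k. (\<integral>\<^sup>+ x. indicator S (x + real_vec k) * indicator unit_cube x \<partial>lborel) \<partial>count_space UNIV)"
    by (rule nn_integral_count_space_nn_integral) auto
  also have "\<dots> = emeasure lborel S" by (rule emeasure_lborel_cube_translates) simp
  finally show ?thesis by (simp add: S_def)
qed

text \<open>\<^const>\<open>measure_of\<close> keeps the values of a set function only if it is countably additive.  The sums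
  over the fibres have this property, because they integrate to the values of an image measure.\<close>

lemma mu_tilde_eq_distr: "mu_tilde A = distr lborel (restrict_space borel (solenoid1 A)) (ihat A)"
proof -
  let ?N = "restrict_space borel (solenoid1 A)"
  let ?M = "distr lborel ?N (ihat A)"
  have sp: "space ?N = solenoid1 A" by (simp add: space_restrict_space)
  have sets: "sets ?N \<subseteq> Pow (solenoid1 A)" using sets.space_closed[of ?N] by (simp add: sp)
  have "mu_tilde A = measure_of (space ?M) (sets ?M) (emeasure ?M)"
    unfolding mu_tilde_def space_distr sets_distr sp
  proof (rule measure_of_eq[OF sets])
    fix E assume "E \<in> sigma_sets (solenoid1 A) (sets ?N)"
    then have E: "E \<in> sets ?N" using sets.sigma_sets_eq[of ?N] by (simp add: sp)
    show "(\<integral>\<^sup>+ z. (\<Sum>\<^sub>\<infinity>w\<in>{w \<in> solenoid1 A. w 0 = z}. indicator E w) \<partial>torus_haar) = emeasure ?M E"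
      using nn_integral_fibre_sum[OF E] by (simp add: emeasure_distr[OF measurable_ihat E])
  qed
  then show ?thesis by (simp only: measure_of_of_measure)
qed

lemma space_mu_tilde [simp]: "space (mu_tilde A) = solenoid1 A"
  and sets_mu_tilde: "sets (mu_tilde A) = sets (restrict_space borel (solenoid1 A))"
  by (simp_all add: mu_tilde_eq_distr space_restrict_space)

lemma measurable_ihat_mu_tilde: "ihat A \<in> measurable lborel (mu_tilde A)"
  using measurable_ihat by (simp add: measurable_cong_sets[OF refl sets_mu_tilde])

lemma measurable_inv_ihat_mu_tilde: "inv_into UNIV (ihat A) \<in> measurable (mu_tilde A) lborel"
  using measurable_inv_ihat by (simp only: measurable_cong_sets[OF sets_mu_tilde sets_lborel])

lemma emeasure_mu_tilde:
  "E \<in> sets (mu_tilde A) \<Longrightarrow> emeasure (mu_tilde A) E = emeasure lborel (ihat A -` E)"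
  using emeasure_distr[OF measurable_ihat, of E] by (simp add: mu_tilde_eq_distr)

lemma measure_preserving_ihat: "measure_preserving_iso lborel (mu_tilde A) (ihat A)"
  using inj_ihat range_ihat measurable_ihat_mu_tilde measurable_inv_ihat_mu_tilde emeasure_mu_tilde
  by (simp add: measure_preserving_iso_def bij_betw_def)

end


section \<open>Operators on square integrable functions\<close>

lemma sq_integrable_add:
  assumes "f \<in> sq_integrable M" "g \<in> sq_integrable M"
  shows "(\<lambda>x. f x + g x) \<in> sq_integrable M"
proof -
  have [measurable]: "f \<in> borel_measurable M" "g \<in> borel_measurable M"
    using assms by (auto simp: sq_integrable_def)
  have "integrable M (\<lambda>x. 2 * (norm (f x))\<^sup>2 + 2 * (norm (g x))\<^sup>2)"
    using assms by (intro Bochner_Integration.integrable_add integrable_mult_right) (auto simp: sq_integrable_def)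
  then have "integrable M (\<lambda>x. (norm (f x + g x))\<^sup>2)"
  proof (rule Bochner_Integration.integrable_bound)
    have "(norm (a + b))\<^sup>2 \<le> 2 * (norm a)\<^sup>2 + 2 * (norm b)\<^sup>2" for a b :: complex
    proof -
      have "(norm (a + b))\<^sup>2 \<le> (norm a + norm b)\<^sup>2"
        by (intro power_mono norm_triangle_ineq) simp
      also have "\<dots> \<le> 2 * (norm a)\<^sup>2 + 2 * (norm b)\<^sup>2"
        using sum_squares_bound[of "norm a" "norm b"] by (simp add: power2_sum)
      finally show ?thesis .
    qed
    then show "AE x in M. norm ((norm (f x + g x))\<^sup>2) \<le> norm (2 * (norm (f x))\<^sup>2 + 2 * (norm (g x))\<^sup>2)"
      by simp
  qed measurable
  then show ?thesis by (simp add: sq_integrable_def)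
qed

lemma sq_integrable_scale:
  assumes "f \<in> sq_integrable M"
  shows "(\<lambda>x. c * f x) \<in> sq_integrable M"
  using assms by (auto simp: sq_integrable_def norm_mult power_mult_distrib)

lemma equiv_ae_eq: "equiv (sq_integrable M) (ae_eq M)"
proof (rule equivI)
  show "sym (ae_eq M)" by (auto simp: sym_def ae_eq_def elim!: eventually_mono)
  show "trans (ae_eq M)" unfolding trans_def ae_eq_def by (auto elim: eventually_elim2)
qed (auto simp: refl_on_def ae_eq_def)

lemma L2_class_in_L2: "f \<in> sq_integrable M \<Longrightarrow> L2_class M f \<in> L2 M"
  by (auto simp: L2_def L2_class_def intro: quotientI)

lemma L2_E:
  assumes "X \<in> L2 M"
  obtains f where "f \<in> sq_integrable M" "X = L2_class M f"
  using assms by (auto simp: L2_def L2_class_def elim: quotientE)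

lemma L2_class_eqI: "(f, g) \<in> ae_eq M \<Longrightarrow> L2_class M f = L2_class M g"
  unfolding L2_class_def by (rule equiv_class_eq[OF equiv_ae_eq])

lemma mem_L2_class: "g \<in> L2_class M f \<longleftrightarrow> (f, g) \<in> ae_eq M"
  by (simp add: L2_class_def)

lemma self_mem_L2_class: "f \<in> sq_integrable M \<Longrightarrow> f \<in> L2_class M f"
  by (simp add: mem_L2_class ae_eq_def)

lemma sq_integrable_cong:
  "(\<And>x. x \<in> space M \<Longrightarrow> f x = g x) \<Longrightarrow> f \<in> sq_integrable M \<longleftrightarrow> g \<in> sq_integrable M"
  unfolding sq_integrable_def by (simp cong: measurable_cong Bochner_Integration.integrable_cong)

lemma L2_class_cong:
  assumes "\<And>x. x \<in> space M \<Longrightarrow> f x = g x"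
  shows "L2_class M f = L2_class M g"
proof -
  have "(AE x in M. f x = h x) \<longleftrightarrow> (AE x in M. g x = h x)" for h
    by (rule AE_cong) (simp add: assms)
  then show ?thesis
    using sq_integrable_cong[of M f g] assms by (auto simp: mem_L2_class ae_eq_def)
qed

lemma L2_lift_cong:
  assumes "\<And>f x. x \<in> space N \<Longrightarrow> T f x = T' f x"
  shows "L2_lift N T = L2_lift N T'"
  using L2_class_cong[of N "T _" "T' _"] assms by (simp add: L2_lift_def fun_eq_iff)

lemma L2_lift_class:
  assumes "\<And>f g. (f, g) \<in> ae_eq M \<Longrightarrow> (T f, T g) \<in> ae_eq N" and "f \<in> sq_integrable M"
  shows "L2_lift N T (L2_class M f) = L2_class N (T f)"
proof -
  have "L2_class N (T g) = L2_class N (T f)" if "g \<in> L2_class M f" for g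
    using assms(1) that by (intro L2_class_eqI[symmetric]) (simp add: mem_L2_class)
  then show ?thesis using self_mem_L2_class[OF assms(2)] unfolding L2_lift_def by blast
qed

lemma L2_add_class:
  assumes "f \<in> sq_integrable M" "g \<in> sq_integrable M"
  shows "L2_add M (L2_class M f) (L2_class M g) = L2_class M (\<lambda>x. f x + g x)"
proof -
  have "L2_class M (\<lambda>x. f' x + g' x) = L2_class M (\<lambda>x. f x + g x)"
    if "f' \<in> L2_class M f" "g' \<in> L2_class M g" for f' g'
    using that by (intro L2_class_eqI[symmetric])
      (auto simp: mem_L2_class ae_eq_def sq_integrable_add elim: eventually_elim2)
  then show ?thesis
    using self_mem_L2_class assms unfolding L2_add_def by blast
qed

lemma L2_scale_class:
  assumes "f \<in> sq_integrable M"
  shows "L2_scale M c (L2_class M f) = L2_class M (\<lambda>x. c * f x)"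
proof -
  have "L2_class M (\<lambda>x. c * f' x) = L2_class M (\<lambda>x. c * f x)" if "f' \<in> L2_class M f" for f'
    using that by (intro L2_class_eqI[symmetric])
      (auto simp: mem_L2_class ae_eq_def sq_integrable_scale elim: eventually_mono)
  then show ?thesis
    using self_mem_L2_class assms unfolding L2_scale_def by blast
qed

lemma L2_inner_class:
  assumes f: "f \<in> sq_integrable M" and g: "g \<in> sq_integrable M"
  shows "L2_inner M (L2_class M f) (L2_class M g) = (LINT x|M. f x * cnj (g x))"
  unfolding L2_inner_def
proof (rule the_equality)
  show "\<exists>f'\<in>L2_class M f. \<exists>g'\<in>L2_class M g.
      (LINT x|M. f x * cnj (g x)) = (LINT x|M. f' x * cnj (g' x))"
    using self_mem_L2_class f g by blast
  fix c assume "\<exists>f'\<in>L2_class M f. \<exists>g'\<in>L2_class M g. c = (LINT x|M. f' x * cnj (g' x))"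
  then obtain f' g' where c: "c = (LINT x|M. f' x * cnj (g' x))"
    and eq: "(f, f') \<in> ae_eq M" "(g, g') \<in> ae_eq M" by (auto simp: mem_L2_class)
  have [measurable]: "f \<in> borel_measurable M" "g \<in> borel_measurable M"
    "f' \<in> borel_measurable M" "g' \<in> borel_measurable M"
    using eq by (auto simp: ae_eq_def sq_integrable_def)
  have [measurable]: "cnj \<in> borel_measurable borel"
    by (intro borel_measurable_continuous_onI continuous_intros)
  have "AE x in M. f' x * cnj (g' x) = f x * cnj (g x)"
    using eq by (auto simp: ae_eq_def elim: eventually_elim2)
  then show "c = (LINT x|M. f x * cnj (g x))"
    unfolding c by (intro integral_cong_AE) measurable
qed


lemma L2_add_in_L2:
  assumes "X \<in> L2 M" "Y \<in> L2 M"
  shows "L2_add M X Y \<in> L2 M"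
proof -
  obtain f where f: "f \<in> sq_integrable M" "X = L2_class M f" using assms(1) by (rule L2_E)
  obtain g where g: "g \<in> sq_integrable M" "Y = L2_class M g" using assms(2) by (rule L2_E)
  show ?thesis by (simp add: f g L2_add_class L2_class_in_L2 sq_integrable_add)
qed

lemma L2_scale_in_L2:
  assumes "X \<in> L2 M"
  shows "L2_scale M c X \<in> L2 M"
proof -
  obtain f where f: "f \<in> sq_integrable M" "X = L2_class M f" using assms by (rule L2_E)
  show ?thesis by (simp add: f L2_scale_class L2_class_in_L2 sq_integrable_scale)
qed

text \<open>The definition of \<^const>\<open>L2_unitary\<close> evaluates the operator only on elements of \<^term>\<open>L2 M\<close>, as sums and
  multiples of such elements are again elements.\<close>

lemma L2_unitary_restrict:
  assumes "L2_unitary M V"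
  shows "L2_unitary M (restrict V (L2 M))"
  using assms
  by (simp add: L2_unitary_def L2_linear_bij_def L2_add_in_L2 L2_scale_in_L2 cong: bij_betw_cong)


section \<open>Weighted composition operators\<close>

text \<open>The common form of the shift on \<^const>\<open>solenoid1\<close>, of the dilations of \<open>\<real>\<^sup>d\<close> and of \<^const>\<open>ihat\<close>; the last
  one relates two different measure spaces, with factor \<open>1\<close>.\<close>

locale scaling_iso =
  fixes N :: "'b measure" and M :: "'a measure" and \<psi> :: "'b \<Rightarrow> 'a" and \<theta> :: "'a \<Rightarrow> 'b" and r :: real
  assumes measurable_fun [measurable]: "\<psi> \<in> measurable N M"
    and measurable_inv [measurable]: "\<theta> \<in> measurable M N"
    and inv_fun: "\<And>x. x \<in> space N \<Longrightarrow> \<theta> (\<psi> x) = x"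
    and fun_inv: "\<And>y. y \<in> space M \<Longrightarrow> \<psi> (\<theta> y) = y"
    and factor_pos: "0 < r"
    and scaling: "\<And>E. E \<in> sets M \<Longrightarrow> emeasure N (\<psi> -` E \<inter> space N) = ennreal r * emeasure M E"
begin

lemma inverse: "scaling_iso M N \<theta> \<psi> (1 / r)"
proof
  fix E assume E: "E \<in> sets N"
  have sub: "E \<subseteq> space N" using E by (rule sets.sets_into_space)
  have "\<psi> -` (\<theta> -` E \<inter> space M) \<inter> space N = E"
    using sub measurable_space[OF measurable_fun] by (auto simp: inv_fun)
  then have "emeasure N E = ennreal r * emeasure M (\<theta> -` E \<inter> space M)"
    using scaling[of "\<theta> -` E \<inter> space M"] E by simp
  then have "ennreal (1 / r) * emeasure N E
      = ennreal (1 / r) * ennreal r * emeasure M (\<theta> -` E \<inter> space M)"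
    by (simp add: mult.assoc)
  also have "ennreal (1 / r) * ennreal r = 1"
    using factor_pos by (simp flip: ennreal_mult)
  finally show "emeasure M (\<theta> -` E \<inter> space M) = ennreal (1 / r) * emeasure N E" by simp
qed (use factor_pos in \<open>auto simp: inv_fun fun_inv\<close>)

lemma distr_eq: "distr N M \<psi> = density M (\<lambda>_. ennreal r)"
  by (rule measure_eqI) (simp_all add: emeasure_distr scaling emeasure_density nn_integral_cmult_indicator)

lemma AE_compose:
  assumes "AE y in M. P y"
  shows "AE x in N. P (\<psi> x)"
proof -
  have "AE y in distr N M \<psi>. P y"
    unfolding distr_eq using assms by (subst AE_density) (auto elim: eventually_mono)
  then show ?thesis by (rule AE_distrD[OF measurable_fun])
qed

lemma integrable_compose_iff:
  fixes f :: "'a \<Rightarrow> 'c::{banach, second_countable_topology}"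
  assumes f: "f \<in> borel_measurable M"
  shows "integrable N (\<lambda>x. f (\<psi> x)) \<longleftrightarrow> integrable M f"
proof -
  have "integrable N (\<lambda>x. f (\<psi> x)) \<longleftrightarrow> integrable (distr N M \<psi>) f"
    using f by (subst integrable_distr_eq) auto
  also have "\<dots> \<longleftrightarrow> integrable M (\<lambda>x. r *\<^sub>R f x)"
    unfolding distr_eq using f factor_pos by (subst integrable_density) auto
  also have "\<dots> \<longleftrightarrow> integrable M f"
  proof
    assume "integrable M (\<lambda>x. r *\<^sub>R f x)"
    then have "integrable M (\<lambda>x. (1 / r) *\<^sub>R r *\<^sub>R f x)" by (rule integrable_scaleR_right)
    then show "integrable M f" using factor_pos by simp
  qed (rule integrable_scaleR_right)
  finally show ?thesis .
qed

lemma integral_compose: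
  fixes f :: "'a \<Rightarrow> 'c::{banach, second_countable_topology}"
  assumes f: "f \<in> borel_measurable M"
  shows "(LINT x|N. f (\<psi> x)) = r *\<^sub>R (LINT y|M. f y)"
proof -
  have "(LINT x|N. f (\<psi> x)) = integral\<^sup>L (distr N M \<psi>) f"
    using f by (subst integral_distr) auto
  also have "\<dots> = (LINT y|M. r *\<^sub>R f y)"
    unfolding distr_eq using f factor_pos by (subst integral_density) auto
  finally show ?thesis by simp
qed

end

lemma scaling_iso_compose:
  assumes "scaling_iso P N \<phi> \<phi>' s" "scaling_iso N M \<psi> \<psi>' r"
  shows "scaling_iso P M (\<lambda>x. \<psi> (\<phi> x)) (\<lambda>y. \<phi>' (\<psi>' y)) (s * r)"
proof -
  interpret P: scaling_iso P N \<phi> \<phi>' s by fact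
  interpret N: scaling_iso N M \<psi> \<psi>' r by fact
  show ?thesis
  proof
    fix E assume E: "E \<in> sets M"
    have "(\<lambda>x. \<psi> (\<phi> x)) -` E \<inter> space P = \<phi> -` (\<psi> -` E \<inter> space N) \<inter> space P"
      using measurable_space[OF P.measurable_fun] by auto
    moreover have "\<psi> -` E \<inter> space N \<in> sets N"
      using E by measurable
    ultimately have "emeasure P ((\<lambda>x. \<psi> (\<phi> x)) -` E \<inter> space P)
        = ennreal s * (ennreal r * emeasure M E)"
      using P.scaling N.scaling[OF E] by metis
    then show "emeasure P ((\<lambda>x. \<psi> (\<phi> x)) -` E \<inter> space P) = ennreal (s * r) * emeasure M E"
      using P.factor_pos N.factor_pos by (simp add: ennreal_mult mult.assoc)
  qed (use P.factor_pos N.factor_pos measurable_space[OF P.measurable_fun]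
      measurable_space[OF N.measurable_inv] in \<open>auto simp: P.inv_fun P.fun_inv N.inv_fun N.fun_inv\<close>)
qed

definition weighted_comp :: "('b \<Rightarrow> complex) \<Rightarrow> ('b \<Rightarrow> 'a) \<Rightarrow> ('a \<Rightarrow> complex) \<Rightarrow> ('b \<Rightarrow> complex)" where
  "weighted_comp w \<psi> f = (\<lambda>x. w x * f (\<psi> x))"

text \<open>If the modulus of the weight compensates the factor by which the map scales the measure,
  the operator is isometric; its inverse is the weighted composition with the inverse map.\<close>

locale balanced_scaling_iso =
  scaling_iso N M \<psi> \<theta> r
  for N :: "'b measure" and M :: "'a measure" and \<psi> \<theta> r +
  fixes w :: "'b \<Rightarrow> complex"
  assumes measurable_weight [measurable]: "w \<in> borel_measurable N"
    and norm_weight: "\<And>x. x \<in> space N \<Longrightarrow> (norm (w x))\<^sup>2 = 1 / r"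
begin

abbreviation "Op \<equiv> weighted_comp w \<psi>"

lemma weight_nz: "x \<in> space N \<Longrightarrow> w x \<noteq> 0"
  using norm_weight[of x] factor_pos by auto

lemma inverse_balanced: "balanced_scaling_iso M N \<theta> \<psi> (1 / r) (\<lambda>y. 1 / w (\<theta> y))"
proof -
  interpret I: scaling_iso M N \<theta> \<psi> "1 / r" by (rule inverse)
  show ?thesis
  proof
    show "(norm (1 / w (\<theta> y)))\<^sup>2 = 1 / (1 / r)" if "y \<in> space M" for y
      using norm_weight[of "\<theta> y"] that measurable_space[OF measurable_inv that]
      by (simp add: norm_divide power_divide)
  qed measurable
qed

lemma Op_sq_integrable:
  assumes "f \<in> sq_integrable M"
  shows "Op f \<in> sq_integrable N"
proof -
  have [measurable]: "f \<in> borel_measurable M" using assms by (simp add: sq_integrable_def)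
  have "integrable N (\<lambda>x. (1 / r) * (norm (f (\<psi> x)))\<^sup>2)"
    using assms integrable_compose_iff[of "\<lambda>y. (norm (f y))\<^sup>2"] by (simp add: sq_integrable_def)
  moreover have "integrable N (\<lambda>x. (1 / r) * (norm (f (\<psi> x)))\<^sup>2)
      \<longleftrightarrow> integrable N (\<lambda>x. (norm (Op f x))\<^sup>2)"
    by (rule Bochner_Integration.integrable_cong)
      (simp_all add: weighted_comp_def norm_mult power_mult_distrib norm_weight)
  ultimately show ?thesis by (simp add: sq_integrable_def weighted_comp_def)
qed

lemma Op_ae_eq:
  assumes "(f, g) \<in> ae_eq M"
  shows "(Op f, Op g) \<in> ae_eq N"
proof -
  have "AE x in N. f (\<psi> x) = g (\<psi> x)"
    using assms by (intro AE_compose) (simp add: ae_eq_def)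
  then have "AE x in N. Op f x = Op g x"
    by (rule eventually_mono) (simp add: weighted_comp_def)
  then show ?thesis using assms by (simp add: ae_eq_def Op_sq_integrable)
qed

lemma lift_class: "f \<in> sq_integrable M \<Longrightarrow> L2_lift N Op (L2_class M f) = L2_class N (Op f)"
  by (rule L2_lift_class[where T = Op]) (simp_all only: Op_ae_eq)

lemma lift_in_L2:
  assumes "X \<in> L2 M"
  shows "L2_lift N Op X \<in> L2 N"
proof -
  obtain f where "f \<in> sq_integrable M" "X = L2_class M f" using assms by (rule L2_E)
  then show ?thesis by (simp add: lift_class L2_class_in_L2 Op_sq_integrable)
qed

lemma lift_inverse:
  assumes "X \<in> L2 M"
  shows "L2_lift M (weighted_comp (\<lambda>y. 1 / w (\<theta> y)) \<theta>) (L2_lift N Op X) = X"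
proof -
  interpret I: balanced_scaling_iso M N \<theta> \<psi> "1 / r" "\<lambda>y. 1 / w (\<theta> y)" by (rule inverse_balanced)
  obtain f where f: "f \<in> sq_integrable M" "X = L2_class M f" using assms by (rule L2_E)
  have "L2_class M (I.Op (Op f)) = L2_class M f"
    by (rule L2_class_cong)
      (simp add: weighted_comp_def fun_inv weight_nz measurable_space[OF measurable_inv])
  then show ?thesis by (simp add: f lift_class I.lift_class Op_sq_integrable)
qed

lemma lift_bij: "bij_betw (L2_lift N Op) (L2 M) (L2 N)"
proof -
  interpret I: balanced_scaling_iso M N \<theta> \<psi> "1 / r" "\<lambda>y. 1 / w (\<theta> y)" by (rule inverse_balanced)
  have "L2_lift N (weighted_comp (\<lambda>x. 1 / (1 / w (\<theta> (\<psi> x)))) \<psi>) = L2_lift N Op"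
    by (rule L2_lift_cong) (simp add: weighted_comp_def inv_fun)
  then have "L2_lift N Op (L2_lift M I.Op Y) = Y" if "Y \<in> L2 N" for Y
    using I.lift_inverse[OF that] by (simp only:)
  then show ?thesis
    by (intro bij_betw_byWitness[where f' = "L2_lift M I.Op"])
      (auto simp: lift_inverse lift_in_L2 I.lift_in_L2)
qed

lemma lift_inner:
  assumes "X \<in> L2 M" "Y \<in> L2 M"
  shows "L2_inner N (L2_lift N Op X) (L2_lift N Op Y) = L2_inner M X Y"
proof -
  obtain f where f: "f \<in> sq_integrable M" "X = L2_class M f" using assms(1) by (rule L2_E)
  obtain g where g: "g \<in> sq_integrable M" "Y = L2_class M g" using assms(2) by (rule L2_E)
  have [measurable]: "f \<in> borel_measurable M" "g \<in> borel_measurable M"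
    using f g by (auto simp: sq_integrable_def)
  have [measurable]: "cnj \<in> borel_measurable borel"
    by (intro borel_measurable_continuous_onI continuous_intros)
  have "L2_inner N (L2_lift N Op X) (L2_lift N Op Y) = (LINT x|N. Op f x * cnj (Op g x))"
    by (simp add: f g lift_class L2_inner_class Op_sq_integrable)
  also have "\<dots> = (LINT x|N. (1 / r) *\<^sub>R (f (\<psi> x) * cnj (g (\<psi> x))))"
  proof (rule Bochner_Integration.integral_cong)
    fix x assume "x \<in> space N"
    then have "w x * cnj (w x) = complex_of_real (1 / r)"
      by (simp only: complex_norm_square[symmetric] norm_weight)
    moreover have "Op f x * cnj (Op g x) = (w x * cnj (w x)) * (f (\<psi> x) * cnj (g (\<psi> x)))"
      by (simp add: weighted_comp_def)
    ultimately show "Op f x * cnj (Op g x) = (1 / r) *\<^sub>R (f (\<psi> x) * cnj (g (\<psi> x)))"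
      by (simp only: scaleR_conv_of_real)
  qed simp
  also have "\<dots> = (1 / r) *\<^sub>R r *\<^sub>R (LINT y|M. f y * cnj (g y))"
    using integral_compose[of "\<lambda>y. f y * cnj (g y)"] by simp
  also have "\<dots> = L2_inner M X Y"
    using factor_pos by (simp add: f g L2_inner_class)
  finally show ?thesis .
qed

lemma lift_linear_bij: "L2_linear_bij M N (L2_lift N Op)"
  unfolding L2_linear_bij_def
proof (intro conjI ballI allI)
  show "bij_betw (L2_lift N Op) (L2 M) (L2 N)" by (rule lift_bij)
  show "L2_lift N Op (L2_add M X Y) = L2_add N (L2_lift N Op X) (L2_lift N Op Y)"
    if "X \<in> L2 M" "Y \<in> L2 M" for X Y
  proof -
    obtain f where "f \<in> sq_integrable M" "X = L2_class M f" using \<open>X \<in> L2 M\<close> by (rule L2_E)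
    moreover obtain g where "g \<in> sq_integrable M" "Y = L2_class M g" using \<open>Y \<in> L2 M\<close> by (rule L2_E)
    ultimately show ?thesis
      by (simp add: L2_add_class lift_class sq_integrable_add Op_sq_integrable)
        (simp add: weighted_comp_def distrib_left)
  qed
  show "L2_lift N Op (L2_scale M c X) = L2_scale N c (L2_lift N Op X)" if "X \<in> L2 M" for c X
  proof -
    obtain f where "f \<in> sq_integrable M" "X = L2_class M f" using \<open>X \<in> L2 M\<close> by (rule L2_E)
    then show ?thesis
      by (simp add: L2_scale_class lift_class sq_integrable_scale Op_sq_integrable)
        (simp add: weighted_comp_def mult_ac)
  qed
qed

lemma lift_isometric_iso: "L2_isometric_iso M N (L2_lift N Op)"
  by (simp add: L2_isometric_iso_def lift_linear_bij L2_norm_def lift_inner)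

end

lemma balanced_scaling_iso_unitary:
  assumes "balanced_scaling_iso M M \<psi> \<theta> r w"
  shows "L2_unitary M (L2_lift M (weighted_comp w \<psi>))"
proof -
  interpret balanced_scaling_iso M M \<psi> \<theta> r w by fact
  show ?thesis by (simp add: L2_unitary_def lift_linear_bij lift_inner)
qed


section \<open>The representation\<close>

context expansive_matrix
begin

text \<open>In the coordinate \<open>x\<close> of the point \<open>ihat A x\<close> the powers of the shift are the dilations \<open>(A\<^sup>T)\<^sup>j\<close>,
  and \<open>z\<^sub>0\<^sup>k\<close> becomes \<open>e\<^sup>2\<^sup>\<pi>\<^sup>i\<^sup>k\<^sup>\<cdot>\<^sup>x\<close>.\<close>

definition coord :: "(nat \<Rightarrow> complex ^ 'd) \<Rightarrow> real ^ 'd" where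
  "coord = inv_into UNIV (ihat A)"

definition move :: "int \<Rightarrow> (nat \<Rightarrow> complex ^ 'd) \<Rightarrow> (nat \<Rightarrow> complex ^ 'd)" where
  "move j z = ihat A (dil j (coord z))"

definition adet :: real where
  "adet = \<bar>real_of_int (det A)\<bar>"

definition phase :: "int \<Rightarrow> real ^ 'd \<Rightarrow> real ^ 'd \<Rightarrow> complex" where
  "phase j b x = cis (2 * pi * (b \<bullet> x)) * of_real (sqrt adet powi j)"

lemma adet_pos: "0 < adet"
  using det_nz by (simp add: adet_def)

lemma coord_ihat [simp]: "coord (ihat A x) = x"
  by (simp add: coord_def inj_ihat)

lemma ihat_coord: "z \<in> solenoid1 A \<Longrightarrow> ihat A (coord z) = z"
  unfolding coord_def by (rule f_inv_into_f) (simp add: range_ihat)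

lemma scaling_iso_ihat: "scaling_iso lborel (mu_tilde A) (ihat A) coord 1"
proof
  show "coord \<in> mu_tilde A \<rightarrow>\<^sub>M lborel"
    using measurable_inv_ihat_mu_tilde by (simp add: coord_def)
  show "ihat A \<in> lborel \<rightarrow>\<^sub>M mu_tilde A" by (rule measurable_ihat_mu_tilde)
qed (auto simp: ihat_coord emeasure_mu_tilde)

lemma scaling_iso_coord: "scaling_iso (mu_tilde A) lborel coord (ihat A) 1"
  using scaling_iso.inverse[OF scaling_iso_ihat] by simp

lemma scaling_iso_dil: "scaling_iso lborel lborel (dil j) (dil (- j)) (1 / adet powi j)"
proof
  show "emeasure lborel (dil j -` E \<inter> space lborel) = ennreal (1 / adet powi j) * emeasure lborel E"
    if "E \<in> sets lborel" for E
    using emeasure_lborel_vimage_linear[OF linear_dil, of j E] that det_nz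
    by (simp add: det_dil adet_def power_int_abs)
qed (use adet_pos in \<open>auto simp: borel_measurable_linear linear_dil\<close>)

lemma scaling_iso_move: "scaling_iso (mu_tilde A) (mu_tilde A) (move j) (move (- j)) (1 / adet powi j)"
  using scaling_iso_compose[OF scaling_iso_compose[OF scaling_iso_coord scaling_iso_dil[of j]] scaling_iso_ihat]
  by (simp add: move_def[abs_def])

lemma solenoid_shift_eq_move: "z \<in> solenoid1 A \<Longrightarrow> solenoid_shift A z = move 1 z"
  by (metis ihat_coord move_def solenoid_shift_ihat)

lemma integral_solenoid_shift:
  fixes f :: "(nat \<Rightarrow> complex ^ 'd) \<Rightarrow> complex"
  assumes f: "integrable (mu_tilde A) f"
  shows "integrable (mu_tilde A) (f \<circ> solenoid_shift A)"
    and "(LINT z|mu_tilde A. (f \<circ> solenoid_shift A) z) = 1 / of_int \<bar>det A\<bar> * (LINT z|mu_tilde A. f z)"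
proof -
  interpret S: scaling_iso "mu_tilde A" "mu_tilde A" "move 1" "move (- 1)" "1 / adet powi 1"
    by (rule scaling_iso_move)
  have meas: "f \<in> borel_measurable (mu_tilde A)" using f by simp
  have eq: "(f \<circ> solenoid_shift A) z = f (move 1 z)" if "z \<in> space (mu_tilde A)" for z
    using that by (simp add: solenoid_shift_eq_move)
  have "integrable (mu_tilde A) (f \<circ> solenoid_shift A) \<longleftrightarrow> integrable (mu_tilde A) (\<lambda>z. f (move 1 z))"
    by (rule Bochner_Integration.integrable_cong[OF refl]) (rule eq)
  then show "integrable (mu_tilde A) (f \<circ> solenoid_shift A)"
    using S.integrable_compose_iff[OF meas] f by blast
  have "(LINT z|mu_tilde A. (f \<circ> solenoid_shift A) z) = (LINT z|mu_tilde A. f (move 1 z))"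
    by (rule Bochner_Integration.integral_cong[OF refl]) (rule eq)
  also have "\<dots> = (1 / adet) *\<^sub>R (LINT z|mu_tilde A. f z)"
    using S.integral_compose[OF meas] by simp
  also have "\<dots> = complex_of_real (1 / adet) * (LINT z|mu_tilde A. f z)"
    by (rule scaleR_conv_of_real)
  also have "complex_of_real (1 / adet) = 1 / of_int \<bar>det A\<bar>"
    unfolding adet_def of_int_abs[symmetric] of_real_divide of_real_of_int_eq by simp
  finally show "(LINT z|mu_tilde A. (f \<circ> solenoid_shift A) z)
      = 1 / of_int \<bar>det A\<bar> * (LINT z|mu_tilde A. f z)" .
qed

lemma norm_phase: "(norm (phase j b x))\<^sup>2 = 1 / (1 / adet powi j)"
proof -
  have "(sqrt adet powi j)\<^sup>2 = (sqrt adet * sqrt adet) powi j"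
    by (metis power2_eq_square power_int_mult_distrib)
  then show ?thesis
    using adet_pos by (simp add: phase_def norm_mult power_mult_distrib norm_power_int)
qed

lemma measurable_phase [measurable]: "phase j b \<in> borel_measurable borel"
  unfolding phase_def by (intro borel_measurable_continuous_onI continuous_intros)

text \<open>On \<open>\<real>\<^sup>d\<close> the group element \<open>(j, b)\<close> acts by \<open>h \<mapsto> e\<^sup>2\<^sup>\<pi>\<^sup>i\<^sup>b\<^sup>\<cdot>\<^sup>x \<bar>det A\<bar>\<^sup>j\<^sup>/\<^sup>2 h ((A\<^sup>T)\<^sup>j x)\<close>.\<close>

definition rep_real :: "int \<times> (real ^ 'd) \<Rightarrow> (real ^ 'd \<Rightarrow> complex) \<Rightarrow> (real ^ 'd \<Rightarrow> complex)" where
  "rep_real g = weighted_comp (phase (fst g) (snd g)) (dil (fst g))"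

text \<open>The same operators in the coordinate on the solenoid.\<close>

definition rep_sol :: "int \<times> (real ^ 'd) \<Rightarrow> ((nat \<Rightarrow> complex ^ 'd) \<Rightarrow> complex) \<Rightarrow>
    ((nat \<Rightarrow> complex ^ 'd) \<Rightarrow> complex)" where
  "rep_sol g = weighted_comp (\<lambda>z. phase (fst g) (snd g) (coord z)) (move (fst g))"

lemma balanced_rep_real:
  "balanced_scaling_iso lborel lborel (dil j) (dil (- j)) (1 / adet powi j) (phase j b)"
proof -
  interpret scaling_iso lborel lborel "dil j" "dil (- j)" "1 / adet powi j" by (rule scaling_iso_dil)
  show ?thesis by standard (auto simp: norm_phase)
qed

lemma balanced_rep_sol:
  "balanced_scaling_iso (mu_tilde A) (mu_tilde A) (move j) (move (- j)) (1 / adet powi j)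
    (\<lambda>z. phase j b (coord z))"
proof -
  interpret C: scaling_iso "mu_tilde A" lborel coord "ihat A" 1 by (rule scaling_iso_coord)
  interpret scaling_iso "mu_tilde A" "mu_tilde A" "move j" "move (- j)" "1 / adet powi j"
    by (rule scaling_iso_move)
  have "(\<lambda>z. phase j b (coord z)) \<in> borel_measurable (mu_tilde A)"
    by (rule measurable_compose[OF C.measurable_fun]) simp
  then show ?thesis by unfold_locales (auto simp: norm_phase)
qed

lemma balanced_W:
  "balanced_scaling_iso (mu_tilde A) lborel coord (ihat A) 1 (\<lambda>_. 1)"
proof -
  interpret scaling_iso "mu_tilde A" lborel coord "ihat A" 1 by (rule scaling_iso_coord)
  show ?thesis by standard auto
qed

abbreviation "Rep g \<equiv> L2_lift (mu_tilde A) (rep_sol g)"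

lemma Rep_unitary: "L2_unitary (mu_tilde A) (Rep g)"
  unfolding rep_sol_def by (rule balanced_scaling_iso_unitary[OF balanced_rep_sol])

lemma T_tilde_eq_Rep: "T_tilde A k = Rep (0, real_vec k)"
  unfolding T_tilde_def
proof (rule L2_lift_cong)
  fix f :: "(nat \<Rightarrow> complex ^ 'd) \<Rightarrow> complex" and z assume "z \<in> space (mu_tilde A)"
  then obtain x where x: "z = ihat A x" by (auto simp: range_ihat[symmetric])
  show "torus_char (z 0) k * f z = rep_sol (0, real_vec k) f z"
    by (simp add: x ihat_0 torus_char_e2pi rep_sol_def weighted_comp_def phase_def move_def)
qed

lemma U_tilde_eq_Rep: "U_tilde A = Rep (1, 0)"
  unfolding U_tilde_def
  by (rule L2_lift_cong)
    (simp add: solenoid_shift_eq_move rep_sol_def weighted_comp_def phase_def adet_def)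

lemma T_hat_eq: "T_hat k = L2_lift lborel (rep_real (0, real_vec k))"
  unfolding T_hat_def by (rule L2_lift_cong) (simp add: rep_real_def weighted_comp_def phase_def)

lemma U_hat_eq: "U_hat A = L2_lift lborel (rep_real (1, 0))"
  unfolding U_hat_def
  by (rule L2_lift_cong)
    (simp add: rep_real_def weighted_comp_def phase_def adet_def dil_def del: transpose_matrix_vector)

lemma W_op_eq: "W_op A = L2_lift (mu_tilde A) (weighted_comp (\<lambda>_. 1) coord)"
  unfolding W_op_def by (rule L2_lift_cong) (simp add: weighted_comp_def coord_def)

lemma W_op_intertwines:
  assumes "X \<in> L2 lborel"
  shows "W_op A (L2_lift lborel (rep_real g) X) = Rep g (W_op A X)"
proof -
  obtain j b where g: "g = (j, b)" by (cases g)
  interpret R: balanced_scaling_iso lborel lborel "dil j" "dil (- j)" "1 / adet powi j" "phase j b"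
    by (rule balanced_rep_real)
  interpret S: balanced_scaling_iso "mu_tilde A" "mu_tilde A" "move j" "move (- j)" "1 / adet powi j"
    "\<lambda>z. phase j b (coord z)" by (rule balanced_rep_sol)
  interpret W: balanced_scaling_iso "mu_tilde A" lborel coord "ihat A" 1 "\<lambda>_. 1" by (rule balanced_W)
  obtain f where f: "f \<in> sq_integrable lborel" "X = L2_class lborel f" using assms by (rule L2_E)
  have "W_op A (L2_lift lborel (rep_real g) X) = L2_class (mu_tilde A) (W.Op (R.Op f))"
    by (simp add: W_op_eq rep_real_def g f R.lift_class W.lift_class R.Op_sq_integrable)
  also have "\<dots> = L2_class (mu_tilde A) (S.Op (W.Op f))"
    by (rule L2_class_cong) (simp add: weighted_comp_def move_def)
  also have "\<dots> = Rep g (W_op A X)"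
    by (simp add: W_op_eq rep_sol_def g f S.lift_class W.lift_class W.Op_sq_integrable)
  finally show ?thesis .
qed

text \<open>The multiplication of \<open>G\<^sub>A\<close> in terms of weights: \<open>b \<cdot> x + c \<cdot> (A\<^sup>T)\<^sup>j x = (A\<^sup>j c + b) \<cdot> x\<close>.\<close>

lemma phase_mult:
  "phase j b x * phase k c (dil j x) = phase (j + k) (mat_powi (real_mat A) j *v c + b) x"
proof -
  have "phase j b x * phase k c (dil j x)
      = cis (2 * pi * (b \<bullet> x)) * cis (2 * pi * (c \<bullet> dil j x)) * of_real (sqrt adet powi j * sqrt adet powi k)"
    by (simp add: phase_def)
  also have "cis (2 * pi * (b \<bullet> x)) * cis (2 * pi * (c \<bullet> dil j x))
      = cis (2 * pi * ((mat_powi (real_mat A) j *v c + b) \<bullet> x))"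
    by (simp add: cis_mult inner_dil inner_add_left algebra_simps)
  also have "sqrt adet powi j * sqrt adet powi k = sqrt adet powi (j + k)"
    using adet_pos by (simp add: power_int_add)
  finally show ?thesis by (simp add: phase_def)
qed

lemma Rep_mult:
  assumes "X \<in> L2 (mu_tilde A)"
  shows "Rep (g \<otimes>\<^bsub>G_A A\<^esub> h) X = Rep g (Rep h X)"
proof -
  obtain j b where g: "g = (j, b)" by (cases g)
  obtain k c where h: "h = (k, c)" by (cases h)
  let ?d = "mat_powi (real_mat A) j *v c + b"
  interpret G: balanced_scaling_iso "mu_tilde A" "mu_tilde A" "move j" "move (- j)" "1 / adet powi j"
    "\<lambda>z. phase j b (coord z)" by (rule balanced_rep_sol)
  interpret H: balanced_scaling_iso "mu_tilde A" "mu_tilde A" "move k" "move (- k)" "1 / adet powi k"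
    "\<lambda>z. phase k c (coord z)" by (rule balanced_rep_sol)
  interpret GH: balanced_scaling_iso "mu_tilde A" "mu_tilde A" "move (j + k)" "move (- (j + k))"
    "1 / adet powi (j + k)" "\<lambda>z. phase (j + k) ?d (coord z)" by (rule balanced_rep_sol)
  obtain f where f: "f \<in> sq_integrable (mu_tilde A)" "X = L2_class (mu_tilde A) f"
    using assms by (rule L2_E)
  have "Rep (g \<otimes>\<^bsub>G_A A\<^esub> h) X = L2_class (mu_tilde A) (GH.Op f)"
    by (simp add: g h G_A_def rep_sol_def f GH.lift_class)
  also have "\<dots> = L2_class (mu_tilde A) (G.Op (H.Op f))"
    by (rule L2_class_cong)
      (simp add: weighted_comp_def move_def dil_dil add.commute[of k j] phase_mult[symmetric] mult.assoc)
  also have "\<dots> = Rep g (Rep h X)"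
    by (simp add: g h rep_sol_def f G.lift_class H.lift_class H.Op_sq_integrable)
  finally show ?thesis .
qed

lemma Rep_bij: "bij_betw (Rep g) (L2 (mu_tilde A)) (L2 (mu_tilde A))"
  using Rep_unitary[of g] by (simp add: L2_unitary_def L2_linear_bij_def)

lemma unitary_rep_Rep:
  "unitary_rep (G_A A) (mu_tilde A) (\<lambda>g. restrict (Rep g) (L2 (mu_tilde A)))"
proof -
  let ?L = "L2 (mu_tilde A)"
  have Bij: "restrict (Rep g) ?L \<in> Bij ?L" for g
    using Rep_bij[of g] by (simp add: Bij_def cong: bij_betw_cong)
  have mult: "restrict (Rep (g \<otimes>\<^bsub>G_A A\<^esub> h)) ?L
      = restrict (Rep g) ?L \<otimes>\<^bsub>BijGroup ?L\<^esub> restrict (Rep h) ?L" for g h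
  proof -
    have "Rep h X \<in> ?L" if "X \<in> ?L" for X
      using Rep_bij[of h] that by (rule bij_betwE[THEN bspec])
    then show ?thesis
      by (simp add: BijGroup_def Bij compose_def Rep_mult cong: restrict_cong)
  qed
  have "(\<lambda>g. restrict (Rep g) ?L) \<in> hom (G_A A) (BijGroup ?L)"
    unfolding hom_def by (simp add: mult) (simp add: BijGroup_def Bij)
  then show ?thesis
    using L2_unitary_restrict[OF Rep_unitary] by (simp add: unitary_rep_def)
qed

text \<open>In \<open>G\<^sub>A\<close> one has \<open>(1, 0) (0, k) = (0, A k) (1, 0)\<close>.\<close>

lemma U_tilde_T_tilde:
  assumes X: "X \<in> L2 (mu_tilde A)"
  shows "U_tilde A (T_tilde A k (inv_into (L2 (mu_tilde A)) (U_tilde A) X)) = T_tilde A (A *v k) X"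
proof -
  let ?L = "L2 (mu_tilde A)"
  define Y where "Y = inv_into ?L (U_tilde A) X"
  have "X \<in> U_tilde A ` ?L"
    using X Rep_bij[of "(1, 0)"] by (simp add: U_tilde_eq_Rep bij_betw_def)
  then have Y: "Y \<in> ?L" "U_tilde A Y = X"
    unfolding Y_def by (rule inv_into_into, rule f_inv_into_f)
  have "real_mat A *v real_vec k = real_vec (A *v k)"
    by (simp add: vec_eq_iff real_vec_def matrix_vector_mult_def)
  then have "(1, 0) \<otimes>\<^bsub>G_A A\<^esub> (0, real_vec k) = (0, real_vec (A *v k)) \<otimes>\<^bsub>G_A A\<^esub> (1, 0)"
    by (simp add: G_A_def)
  then have "U_tilde A (T_tilde A k Y) = T_tilde A (A *v k) (U_tilde A Y)"
    using Rep_mult[OF Y(1)] by (metis T_tilde_eq_Rep U_tilde_eq_Rep)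
  then show ?thesis using Y(2) by (simp add: Y_def)
qed

lemma W_op_isometric_iso: "L2_isometric_iso lborel (mu_tilde A) (W_op A)"
  unfolding W_op_eq by (rule balanced_scaling_iso.lift_isometric_iso[OF balanced_W])

end

theorem theorem4p4:
  fixes A :: "int ^ 'd ^ 'd"
  assumes "expansive A"
  shows
    "(\<forall>f :: (nat \<Rightarrow> complex ^ 'd) \<Rightarrow> complex. integrable (mu_tilde A) f \<longrightarrow>
        integrable (mu_tilde A) (f \<circ> solenoid_shift A) \<and>
        (LINT z|mu_tilde A. (f \<circ> solenoid_shift A) z) =
          1 / of_int \<bar>det A\<bar> * (LINT z|mu_tilde A. f z))
     \<and> ((\<forall>k. L2_unitary (mu_tilde A) (T_tilde A k)) \<and>
        L2_unitary (mu_tilde A) (U_tilde A) \<and>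
        (\<forall>k. \<forall>X\<in>L2 (mu_tilde A).
          U_tilde A (T_tilde A k (inv_into (L2 (mu_tilde A)) (U_tilde A) X)) = T_tilde A (A *v k) X) \<and>
        (\<exists>\<pi>. unitary_rep (G_A A) (mu_tilde A) \<pi> \<and>
          \<pi> (1, 0) = restrict (U_tilde A) (L2 (mu_tilde A)) \<and>
          (\<forall>k. \<pi> (0, real_vec k) = restrict (T_tilde A k) (L2 (mu_tilde A)))))
     \<and> measure_preserving_iso lborel (mu_tilde A) (ihat A)
     \<and> (L2_isometric_iso lborel (mu_tilde A) (W_op A) \<and>
        (\<forall>k. \<forall>X\<in>L2 lborel. W_op A (T_hat k X) = T_tilde A k (W_op A X)) \<and>
        (\<forall>X\<in>L2 lborel. W_op A (U_hat A X) = U_tilde A (W_op A X)))"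
proof -
  interpret expansive_matrix A by standard (rule assms)
  have "\<exists>\<pi>. unitary_rep (G_A A) (mu_tilde A) \<pi> \<and>
      \<pi> (1, 0) = restrict (U_tilde A) (L2 (mu_tilde A)) \<and>
      (\<forall>k. \<pi> (0, real_vec k) = restrict (T_tilde A k) (L2 (mu_tilde A)))"
    by (intro exI[of _ "\<lambda>g. restrict (Rep g) (L2 (mu_tilde A))"])
      (simp add: unitary_rep_Rep T_tilde_eq_Rep U_tilde_eq_Rep)
  moreover have "L2_unitary (mu_tilde A) (T_tilde A k)" "L2_unitary (mu_tilde A) (U_tilde A)" for k
    by (simp_all add: T_tilde_eq_Rep U_tilde_eq_Rep Rep_unitary)
  moreover have "W_op A (T_hat k X) = T_tilde A k (W_op A X)" "W_op A (U_hat A X) = U_tilde A (W_op A X)"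
    if "X \<in> L2 lborel" for k X
    using that by (simp_all add: T_hat_eq U_hat_eq T_tilde_eq_Rep U_tilde_eq_Rep W_op_intertwines)
  ultimately show ?thesis
    by (intro conjI allI impI ballI integral_solenoid_shift U_tilde_T_tilde measure_preserving_ihat
        W_op_isometric_iso)
qed

end
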